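(* Let $\mathcal{M}=\mathcal{M}(\Sigma,I)$ be an irreducible trace monoid. Then: 1. If $\mathbb{P}$ is a Bernoulli measure on the boundary $(\partial\mathcal{M},\mathfrak{F})$ of $\mathcal{M}$, then the valuation $u\in\mathcal{M}\mapsto\mathbb{P}(\uparrow u)$ induced by $\mathbb{P}$ is a Möbius valuation. 2. If $f:\mathcal{M}\to\mathbb{R}_+^*$ is a Möbius valuation, then there exists a unique Bernoulli measure $\mathbb{P}$ on $(\partial\mathcal{M},\mathfrak{F})$ such that $\mathbb{P}(\uparrow u)=f(u)$ for all $u\in\mathcal{M}$.
   Context: Trace monoids. An independence pair $(\Sigma,I)$ consists of a finite non-empty set $\Sigma$ (letters) and an irreflexive symmetric relation $I\subseteq\Sigma\times\Sigma$. The trace monoid is $\mathcal{M}=\mathcal{M}(\Sigma,I)=\langle\Sigma\mid\alpha\cdot\beta=\beta\cdot\alpha\text{ for }(\alpha,\beta)\in I\rangle$; its elements are called traces, its unit is denoted $0$, and $|u|$ is the length of any word representing $u$. It is irreducible if the undirected graph $(\Sigma,D)$, with $D=(\Sigma\times\Sigma)\setminus I$, is connected. Left divisibility: $u\leq v$ iff $v=u\cdot w$ for some $w\in\mathcal{M}$; this is a partial order. Cliques. A clique is a trace of the form $\alpha_1\cdot\ldots\cdot\alpha_n$, $n\geq0$, with $(\alpha_i,\alpha_j)\in I$ for all $i\neq j$; it is identified with the set of its letters. $\mathscr{C}$ is the (finite) set of cliques and $\mathfrak{C}=\mathscr{C}\setminus\{0\}$ the set of non-empty cliques. Boundary. Consider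 non-decreasing sequences $(u_k)_{k\geq0}$ in $(\mathcal{M},\leq)$, pre-ordered by $(u_k)\preccurlyeq(u'_k)$ iff for every $k$ there is $k'$ with $u_k\leq u'_{k'}$. Let $(\mathcal{W},\leq)$ be the partial order obtained by quotienting by the associated equivalence. $\mathcal{M}$ embeds in $\mathcal{W}$ through constant sequences. The boundary is $\partial\mathcal{M}=\mathcal{W}\setminus\mathcal{M}$ (infinite traces). For $u\in\mathcal{M}$, $\uparrow u=\{\xi\in\partial\mathcal{M}: u\leq\xi\}$, and $\mathfrak{F}$ is the $\sigma$-algebra on $\partial\mathcal{M}$ generated by all sets $\uparrow u$, $u\in\mathcal{M}$. Bernoulli measures. A probability measure $\mathbb{P}$ on $(\partial\mathcal{M},\mathfrak{F})$ is Bernoulli if $\mathbb{P}(\uparrow u)>0$ for all $u\in\mathcal{M}$ and $\mathbb{P}(\uparrow(u\cdot v))=\mathbb{P}(\uparrow u)\,\mathbb{P}(\uparrow v)$ for all $u,v\in\mathcal{M}$. Möbius valuations. $\mathbb{R}_+^*$ is the set of positive reals. A valuation is a function $f:\mathcal{M}\to\mathbb{R}_+^*$ with $f(u\cdot v)=f(u)f(v)$ for all $u,v\in\mathcal{M}$. Its Möbius transform is $h:\mathscr{C}\to\mathbb{R}$, $h(c)=\sum_{c'\in\mathscr{C},\,c\leq c'}(-1)^{|c'|-|c|}f(c')$. The valuation $f$ is a Möbius valuation if $h(0)=0$ and $h(c)>0$ for all $c\in\mathfrak{C}$. *)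

theory Defs
  imports "HOL-Probability.Probability" "HOL-Algebra.Divisibility"
begin

locale independence_pair =
  fixes \<Sigma> :: "'a set" and I :: "('a \<times> 'a) set"
  assumes finite_letters: "finite \<Sigma>"
    and letters_nonempty: "\<Sigma> \<noteq> {}"
    and indep_subset: "I \<subseteq> \<Sigma> \<times> \<Sigma>"
    and indep_irrefl: "irrefl I"
    and indep_sym: "sym I"

text \<open>
  The congruence on the free monoid of words over \<open>\<Sigma>\<close> generated by \<open>\<alpha>\<beta> = \<beta>\<alpha>\<close>
  for \<open>(\<alpha>, \<beta>) \<in> I\<close>; a trace is an equivalence class of words.
\<close>

inductive trace_cong :: "'a set \<Rightarrow> ('a \<times> 'a) set \<Rightarrow> 'a list \<Rightarrow> 'a list \<Rightarrow> bool"
  for \<Sigma> I where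
  comm: "(a, b) \<in> I \<Longrightarrow> trace_cong \<Sigma> I [a, b] [b, a]"
| refl: "w \<in> lists \<Sigma> \<Longrightarrow> trace_cong \<Sigma> I w w"
| sym: "trace_cong \<Sigma> I v w \<Longrightarrow> trace_cong \<Sigma> I w v"
| trans: "trace_cong \<Sigma> I u v \<Longrightarrow> trace_cong \<Sigma> I v w \<Longrightarrow> trace_cong \<Sigma> I u w"
| append: "trace_cong \<Sigma> I v w \<Longrightarrow> trace_cong \<Sigma> I v' w' \<Longrightarrow> trace_cong \<Sigma> I (v @ v') (w @ w')"

definition trace_rel :: "'a set \<Rightarrow> ('a \<times> 'a) set \<Rightarrow> ('a list \<times> 'a list) set" where
  "trace_rel \<Sigma> I = {(v, w). trace_cong \<Sigma> I v w}"

definition trace_of :: "'a set \<Rightarrow> ('a \<times> 'a) set \<Rightarrow> 'a list \<Rightarrow> 'a list set" where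
  "trace_of \<Sigma> I w = trace_rel \<Sigma> I `` {w}"

definition trace_monoid :: "'a set \<Rightarrow> ('a \<times> 'a) set \<Rightarrow> 'a list set monoid" where
  "trace_monoid \<Sigma> I =
    \<lparr> carrier = lists \<Sigma> // trace_rel \<Sigma> I,
      mult = (\<lambda>u v. \<Union>x\<in>u. \<Union>y\<in>v. trace_of \<Sigma> I (x @ y)),
      one = trace_of \<Sigma> I [] \<rparr>"

text \<open>All words representing a trace have the same length.\<close>

definition trace_length :: "'a list set \<Rightarrow> nat" where
  "trace_length u = the_elem (length ` u)"

definition irreducible_trace_monoid :: "'a set \<Rightarrow> ('a \<times> 'a) set \<Rightarrow> bool" where
  "irreducible_trace_monoid \<Sigma> I \<longleftrightarrow> (\<forall>a\<in>\<Sigma>. \<forall>b\<in>\<Sigma>. (a, b) \<in> (\<Sigma> \<times> \<Sigma> - I)\<^sup>*)"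

definition trace_cliques :: "'a set \<Rightarrow> ('a \<times> 'a) set \<Rightarrow> 'a list set set" where
  "trace_cliques \<Sigma> I =
    {trace_of \<Sigma> I w | w. w \<in> lists \<Sigma> \<and>
      (\<forall>i<length w. \<forall>j<length w. i \<noteq> j \<longrightarrow> (w ! i, w ! j) \<in> I)}"

text \<open>
  Left divisibility of traces is the relation \<^const>\<open>factor\<close> of the monoid
  (infix \<open>divides\<close>): \<open>u\<close> divides \<open>v\<close> iff \<open>v = u \<otimes> w\<close> for some \<open>w\<close> in the carrier.
\<close>

definition trace_seqs :: "'a set \<Rightarrow> ('a \<times> 'a) set \<Rightarrow> (nat \<Rightarrow> 'a list set) set" where
  "trace_seqs \<Sigma> I =
    {s. range s \<subseteq> carrier (trace_monoid \<Sigma> I) \<and>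
        monotone (\<le>) (factor (trace_monoid \<Sigma> I)) s}"

definition trace_seq_le ::
  "'a set \<Rightarrow> ('a \<times> 'a) set \<Rightarrow> (nat \<Rightarrow> 'a list set) \<Rightarrow> (nat \<Rightarrow> 'a list set) \<Rightarrow> bool" where
  "trace_seq_le \<Sigma> I s t \<longleftrightarrow> (\<forall>k. \<exists>k'. s k divides\<^bsub>trace_monoid \<Sigma> I\<^esub> t k')"

definition trace_seq_rel ::
  "'a set \<Rightarrow> ('a \<times> 'a) set \<Rightarrow> ((nat \<Rightarrow> 'a list set) \<times> (nat \<Rightarrow> 'a list set)) set" where
  "trace_seq_rel \<Sigma> I =
    {(s, t). s \<in> trace_seqs \<Sigma> I \<and> t \<in> trace_seqs \<Sigma> I \<and>
             trace_seq_le \<Sigma> I s t \<and> trace_seq_le \<Sigma> I t s}"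

definition gen_traces :: "'a set \<Rightarrow> ('a \<times> 'a) set \<Rightarrow> (nat \<Rightarrow> 'a list set) set set" where
  "gen_traces \<Sigma> I = trace_seqs \<Sigma> I // trace_seq_rel \<Sigma> I"

definition gen_trace_le ::
  "'a set \<Rightarrow> ('a \<times> 'a) set \<Rightarrow> (nat \<Rightarrow> 'a list set) set \<Rightarrow> (nat \<Rightarrow> 'a list set) set \<Rightarrow> bool" where
  "gen_trace_le \<Sigma> I \<xi> \<eta> \<longleftrightarrow> (\<exists>s\<in>\<xi>. \<exists>t\<in>\<eta>. trace_seq_le \<Sigma> I s t)"

definition trace_embed ::
  "'a set \<Rightarrow> ('a \<times> 'a) set \<Rightarrow> 'a list set \<Rightarrow> (nat \<Rightarrow> 'a list set) set" where
  "trace_embed \<Sigma> I u = trace_seq_rel \<Sigma> I `` {\<lambda>_. u}"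

definition boundary :: "'a set \<Rightarrow> ('a \<times> 'a) set \<Rightarrow> (nat \<Rightarrow> 'a list set) set set" where
  "boundary \<Sigma> I = gen_traces \<Sigma> I - trace_embed \<Sigma> I ` carrier (trace_monoid \<Sigma> I)"

definition cylinder ::
  "'a set \<Rightarrow> ('a \<times> 'a) set \<Rightarrow> 'a list set \<Rightarrow> (nat \<Rightarrow> 'a list set) set set" where
  "cylinder \<Sigma> I u = {\<xi> \<in> boundary \<Sigma> I. gen_trace_le \<Sigma> I (trace_embed \<Sigma> I u) \<xi>}"

text \<open>
  Only the space and the \<open>\<sigma>\<close>-algebra of the following are relevant; as a measure it is
  the null measure.
\<close>

definition boundary_space :: "'a set \<Rightarrow> ('a \<times> 'a) set \<Rightarrow> (nat \<Rightarrow> 'a list set) set measure" where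
  "boundary_space \<Sigma> I =
    sigma (boundary \<Sigma> I) (cylinder \<Sigma> I ` carrier (trace_monoid \<Sigma> I))"

definition bernoulli_measure ::
  "'a set \<Rightarrow> ('a \<times> 'a) set \<Rightarrow> (nat \<Rightarrow> 'a list set) set measure \<Rightarrow> bool" where
  "bernoulli_measure \<Sigma> I P \<longleftrightarrow>
    prob_space P \<and>
    space P = space (boundary_space \<Sigma> I) \<and>
    sets P = sets (boundary_space \<Sigma> I) \<and>
    (\<forall>u\<in>carrier (trace_monoid \<Sigma> I). measure P (cylinder \<Sigma> I u) > 0) \<and>
    (\<forall>u\<in>carrier (trace_monoid \<Sigma> I). \<forall>v\<in>carrier (trace_monoid \<Sigma> I).
      measure P (cylinder \<Sigma> I (u \<otimes>\<^bsub>trace_monoid \<Sigma> I\<^esub> v)) =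
      measure P (cylinder \<Sigma> I u) * measure P (cylinder \<Sigma> I v))"

definition valuation :: "'a set \<Rightarrow> ('a \<times> 'a) set \<Rightarrow> ('a list set \<Rightarrow> real) \<Rightarrow> bool" where
  "valuation \<Sigma> I f \<longleftrightarrow>
    (\<forall>u\<in>carrier (trace_monoid \<Sigma> I). f u > 0) \<and>
    (\<forall>u\<in>carrier (trace_monoid \<Sigma> I). \<forall>v\<in>carrier (trace_monoid \<Sigma> I).
      f (u \<otimes>\<^bsub>trace_monoid \<Sigma> I\<^esub> v) = f u * f v)"

text \<open>The subtraction of lengths is on \<^typ>\<open>nat\<close>, but never truncates since \<open>c\<close> divides \<open>c'\<close>.\<close>

definition moebius_transform ::
  "'a set \<Rightarrow> ('a \<times> 'a) set \<Rightarrow> ('a list set \<Rightarrow> real) \<Rightarrow> 'a list set \<Rightarrow> real" where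
  "moebius_transform \<Sigma> I f c =
    (\<Sum>c' | c' \<in> trace_cliques \<Sigma> I \<and> c divides\<^bsub>trace_monoid \<Sigma> I\<^esub> c'.
      (- 1) ^ (trace_length c' - trace_length c) * f c')"

definition moebius_valuation :: "'a set \<Rightarrow> ('a \<times> 'a) set \<Rightarrow> ('a list set \<Rightarrow> real) \<Rightarrow> bool" where
  "moebius_valuation \<Sigma> I f \<longleftrightarrow>
    valuation \<Sigma> I f \<and>
    moebius_transform \<Sigma> I f \<one>\<^bsub>trace_monoid \<Sigma> I\<^esub> = 0 \<and>
    (\<forall>c\<in>trace_cliques \<Sigma> I - {\<one>\<^bsub>trace_monoid \<Sigma> I\<^esub>}. moebius_transform \<Sigma> I f c > 0)"

end

theory Submission imports Defs "HOL-Library.Sublist" begin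

text \<open>
  A trace is determined by its projections to pairs of dependent letters, and left divisibility is
  the prefix order on all these projections. Hence the divisors of a trace are compared by counting
  letters, traces with a common multiple have a least one, and every trace has a largest divisor
  obeying given bounds on the letter counts, its truncation.

  For a set \<open>N\<close> of letters let \<open>m(N) = \<Sum>(-1)^|d| f(d)\<close>, summed over the cliques \<open>d \<subseteq> N\<close>. If
  \<open>f(u)\<close> is the measure of the cylinder of \<open>u\<close>, then inclusion-exclusion gives the measure
  \<open>f(v) m(N)\<close> to the set of infinite traces above \<open>v\<close> but above no \<open>v a\<close> with \<open>a \<in> N\<close>. For
  \<open>v = \<epsilon>\<close> and \<open>N = \<Sigma>\<close> this set is empty and the measure is \<open>h(\<epsilon>)\<close>; for a clique \<open>c\<close> and the set
  \<open>N\<close> of letters independent of \<open>c\<close> the measure is \<open>h(c)\<close>, and by irreducibility the set contains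
  a whole cylinder.

  Conversely, if \<open>f\<close> is a Moebius valuation then \<open>m(N)\<close> is the sum of \<open>h(c)\<close> over the cliques
  disjoint from \<open>N\<close>, hence non-negative. So \<open>f(y) m({a. |y|\<^sub>a < n})\<close> are the weights of a probability
  on the finite set of traces containing every letter at most \<open>n\<close> times, under which the traces
  above \<open>u\<close> have probability \<open>f(u)\<close>. Truncation makes these probabilities consistent, so that the
  theorem of Ionescu Tulcea yields a law for the sequence of truncations of an infinite trace; no
  finite trace is charged because \<open>m(\<Sigma>) = h(\<epsilon>) = 0\<close>. Uniqueness holds because the cylinders form a
  \<open>\<pi>\<close>-system.
\<close>

section \<open>Projections of words to pairs of letters\<close>

definition proj :: "'a \<Rightarrow> 'a \<Rightarrow> 'a list \<Rightarrow> 'a list" where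
  "proj a b = filter (\<lambda>x. x = a \<or> x = b)"

lemma proj_simps [simp]:
  "proj a b [] = []"
  "proj a b (x # xs) = (if x = a \<or> x = b then x # proj a b xs else proj a b xs)"
  "proj a b (xs @ ys) = proj a b xs @ proj a b ys"
  by (auto simp: proj_def)

lemma proj_commute: "proj a b xs = proj b a xs"
  by (simp add: proj_def disj_commute)

lemma set_proj: "set (proj a b xs) = set xs \<inter> {a, b}"
  by (auto simp: proj_def)

lemma proj_eq_Nil_iff: "proj a b xs = [] \<longleftrightarrow> a \<notin> set xs \<and> b \<notin> set xs"
  by (auto simp: proj_def filter_empty_conv)

lemma length_proj: "length (proj a b xs) = count_list xs a + (if a = b then 0 else count_list xs b)"
  by (induction xs) auto

section \<open>The trace monoid\<close>

lemma (in monoid) one_divides: "a \<in> carrier G \<Longrightarrow> \<one> divides a"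
  by (rule unit_divides) simp_all

lemma (in monoid) divides_mult: "b \<in> carrier G \<Longrightarrow> a divides a \<otimes> b"
  by (rule dividesI) simp_all

lemma (in monoid_cancel) bij_betw_mult_left:
  assumes "a \<in> carrier G"
  shows "bij_betw (\<lambda>b. a \<otimes> b) {b \<in> carrier G. a \<otimes> b \<in> B} {c \<in> B. a divides c}"
  by (rule bij_betw_imageI) (use assms l_cancel in \<open>auto simp: inj_on_def factor_def\<close>)

context independence_pair
begin

abbreviation T :: "'a list \<Rightarrow> 'a list set" where "T \<equiv> trace_of \<Sigma> I"
abbreviation M :: "'a list set monoid" where "M \<equiv> trace_monoid \<Sigma> I"
abbreviation trace_eq :: "'a list \<Rightarrow> 'a list \<Rightarrow> bool" where "trace_eq \<equiv> trace_cong \<Sigma> I"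

abbreviation trace_mult :: "'a list set \<Rightarrow> 'a list set \<Rightarrow> 'a list set" (infixl "\<odot>" 70) where
  "u \<odot> v \<equiv> u \<otimes>\<^bsub>M\<^esub> v"
abbreviation trace_divides :: "'a list set \<Rightarrow> 'a list set \<Rightarrow> bool" (infix "\<preceq>" 50) where
  "u \<preceq> v \<equiv> u divides\<^bsub>M\<^esub> v"
abbreviation empty_trace :: "'a list set" ("\<epsilon>") where "\<epsilon> \<equiv> \<one>\<^bsub>M\<^esub>"

definition D :: "('a \<times> 'a) set" where "D = \<Sigma> \<times> \<Sigma> - I"

lemma indep_letters: "(a, b) \<in> I \<Longrightarrow> a \<in> \<Sigma> \<and> b \<in> \<Sigma>"
  using indep_subset by auto

lemma indep_neq: "(a, b) \<in> I \<Longrightarrow> a \<noteq> b"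
  using indep_irrefl by (auto simp: irrefl_def)

lemma indep_commute: "(a, b) \<in> I \<longleftrightarrow> (b, a) \<in> I"
  using indep_sym by (auto simp: sym_def)

lemma dep_refl: "a \<in> \<Sigma> \<Longrightarrow> (a, a) \<in> D"
  using indep_neq by (auto simp: D_def)

lemma dep_commute: "(a, b) \<in> D \<longleftrightarrow> (b, a) \<in> D"
  using indep_commute by (auto simp: D_def)

lemma dep_letters: "(a, b) \<in> D \<Longrightarrow> a \<in> \<Sigma> \<and> b \<in> \<Sigma>"
  by (auto simp: D_def)

lemma dep_iff_not_indep: "a \<in> \<Sigma> \<Longrightarrow> b \<in> \<Sigma> \<Longrightarrow> (a, b) \<in> D \<longleftrightarrow> (a, b) \<notin> I"
  by (auto simp: D_def)

lemma trace_eq_letters: "trace_eq xs ys \<Longrightarrow> set xs \<subseteq> \<Sigma> \<and> set ys \<subseteq> \<Sigma>"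
  by (induction rule: trace_cong.induct) (auto dest: indep_letters)

lemma trace_eq_refl: "set xs \<subseteq> \<Sigma> \<Longrightarrow> trace_eq xs xs"
  by (simp add: trace_cong.refl lists_eq_set)

declare trace_cong.trans [trans]

lemma trace_eq_mset: "trace_eq xs ys \<Longrightarrow> mset xs = mset ys"
  by (induction rule: trace_cong.induct) auto

lemma trace_eq_proj: "trace_eq xs ys \<Longrightarrow> (a, b) \<in> D \<Longrightarrow> proj a b xs = proj a b ys"
proof (induction rule: trace_cong.induct)
  case (comm c d)
  then have "(d, c) \<in> I" "c \<noteq> d" using indep_commute indep_neq by blast+
  with comm show ?case by (auto simp: D_def)
qed auto

lemma trace_eq_append_left: "set xs \<subseteq> \<Sigma> \<Longrightarrow> trace_eq ys zs \<Longrightarrow> trace_eq (xs @ ys) (xs @ zs)"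
  by (intro trace_cong.append trace_eq_refl)

lemma trace_eq_append_right: "set zs \<subseteq> \<Sigma> \<Longrightarrow> trace_eq xs ys \<Longrightarrow> trace_eq (xs @ zs) (ys @ zs)"
  by (intro trace_cong.append trace_eq_refl)

lemma trace_eq_commute_letter:
  assumes "a \<in> \<Sigma>" "set xs \<subseteq> \<Sigma>" "\<forall>x\<in>set xs. (x, a) \<in> I"
  shows "trace_eq (xs @ [a]) (a # xs)"
  using assms(2,3)
proof (induction xs rule: list.induct)
  case Nil
  show ?case using assms(1) by (auto intro: trace_eq_refl)
next
  case (Cons x xs)
  have "trace_eq ((x # xs) @ [a]) (x # a # xs)"
    using Cons trace_eq_append_left[of "[x]"] by simp
  also have "trace_eq (x # a # xs) (a # x # xs)"
    using Cons trace_eq_append_right[OF _ trace_cong.comm, of xs x a] by simp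
  finally show ?case .
qed

lemma trace_eq_Cons_if_first:
  assumes "a \<in> \<Sigma>" "set ys \<subseteq> \<Sigma>" and first: "\<And>b. (a, b) \<in> D \<Longrightarrow> prefix [a] (proj a b ys)"
  obtains ys' where "trace_eq (a # ys') ys"
proof -
  have "a \<in> set ys" using set_mono_prefix[OF first[OF dep_refl]] assms(1) by (simp add: set_proj)
  then obtain ps qs where ys: "ys = ps @ a # qs" and "a \<notin> set ps" by (meson split_list_first)
  have "(b, a) \<in> I" if "b \<in> set ps" for b
  proof (rule ccontr)
    assume "(b, a) \<notin> I"
    then have "(a, b) \<in> D"
      using that assms(1,2) ys by (auto simp: dep_iff_not_indep dep_commute[of a b])
    then have "prefix [a] (proj a b ps @ a # proj a b qs)" using first ys by fastforce
    moreover have "proj a b ps \<noteq> []" using that by (simp add: proj_eq_Nil_iff)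
    moreover have "a \<notin> set (proj a b ps)" using \<open>a \<notin> set ps\<close> by (simp add: set_proj)
    ultimately show False by (cases "proj a b ps") auto
  qed
  then have "trace_eq ((ps @ [a]) @ qs) ((a # ps) @ qs)"
    using assms(1,2) ys by (intro trace_eq_append_right trace_eq_commute_letter) auto
  then have "trace_eq (a # ps @ qs) ys" using ys trace_cong.sym by simp
  then show thesis by (rule that)
qed

lemma trace_eq_append_if_proj_prefix:
  assumes "set xs \<subseteq> \<Sigma>" "set ys \<subseteq> \<Sigma>"
    and "\<And>a b. (a, b) \<in> D \<Longrightarrow> prefix (proj a b xs) (proj a b ys)"
  shows "\<exists>zs. set zs \<subseteq> \<Sigma> \<and> trace_eq (xs @ zs) ys"
  using assms
proof (induction xs arbitrary: ys rule: list.induct)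
  case Nil
  then show ?case by (auto intro: trace_eq_refl)
next
  case (Cons a xs)
  then have "a \<in> \<Sigma>" by auto
  moreover have "prefix [a] (proj a b ys)" if "(a, b) \<in> D" for b
    using Cons.prems(3)[OF that] by (auto dest: append_prefixD[of "[a]", simplified])
  ultimately obtain ys' where ys': "trace_eq (a # ys') ys"
    using trace_eq_Cons_if_first Cons.prems(2) by metis
  have "prefix (proj b c xs) (proj b c ys')" if "(b, c) \<in> D" for b c
    using Cons.prems(3)[OF that] trace_eq_proj[OF ys' that, symmetric] by (auto split: if_splits)
  then obtain zs where zs: "set zs \<subseteq> \<Sigma>" "trace_eq (xs @ zs) ys'"
    using Cons.IH[of ys'] Cons.prems(1) trace_eq_letters[OF ys'] by auto
  have "trace_eq ((a # xs) @ zs) (a # ys')"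
    using \<open>a \<in> \<Sigma>\<close> zs(2) trace_eq_append_left[of "[a]"] by simp
  also note ys'
  finally have "trace_eq ((a # xs) @ zs) ys" .
  with zs(1) show ?case by blast
qed

lemma trace_eq_iff_proj_eq:
  assumes "set xs \<subseteq> \<Sigma>" "set ys \<subseteq> \<Sigma>"
  shows "trace_eq xs ys \<longleftrightarrow> (\<forall>a b. (a, b) \<in> D \<longrightarrow> proj a b xs = proj a b ys)"
proof
  assume proj_eq: "\<forall>a b. (a, b) \<in> D \<longrightarrow> proj a b xs = proj a b ys"
  then obtain zs where zs: "set zs \<subseteq> \<Sigma>" "trace_eq (xs @ zs) ys"
    using trace_eq_append_if_proj_prefix[OF assms] by auto
  have "proj a a zs = []" if "a \<in> \<Sigma>" for a
    using trace_eq_proj[OF zs(2) dep_refl[OF that]] proj_eq dep_refl[OF that] by simp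
  then have "zs = []" using zs(1) by (cases zs) (fastforce simp: proj_eq_Nil_iff)+
  with zs(2) show "trace_eq xs ys" by simp
qed (blast intro: trace_eq_proj)

lemma equiv_trace_rel: "equiv (lists \<Sigma>) (trace_rel \<Sigma> I)"
  by (rule equivI)
    (auto simp: trace_rel_def refl_on_def sym_def trans_def lists_eq_set
      dest: trace_eq_letters intro: trace_eq_refl trace_cong.sym trace_cong.trans)

lemma mem_trace_of_iff: "ys \<in> T xs \<longleftrightarrow> trace_eq xs ys"
  by (simp add: trace_of_def trace_rel_def)

lemma trace_of_eq_iff_trace_eq: "set xs \<subseteq> \<Sigma> \<Longrightarrow> set ys \<subseteq> \<Sigma> \<Longrightarrow> T xs = T ys \<longleftrightarrow> trace_eq xs ys"
  using eq_equiv_class_iff[OF equiv_trace_rel]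
  by (simp add: trace_of_def trace_rel_def lists_eq_set)

lemma trace_of_eq_iff_proj_eq:
  "set xs \<subseteq> \<Sigma> \<Longrightarrow> set ys \<subseteq> \<Sigma> \<Longrightarrow>
    T xs = T ys \<longleftrightarrow> (\<forall>a b. (a, b) \<in> D \<longrightarrow> proj a b xs = proj a b ys)"
  by (simp add: trace_of_eq_iff_trace_eq trace_eq_iff_proj_eq)

lemma carrier_eq: "carrier M = T ` {xs. set xs \<subseteq> \<Sigma>}"
  by (auto simp: trace_monoid_def quotient_def trace_of_def lists_eq_set)

lemma carrierE:
  assumes "u \<in> carrier M" obtains xs where "set xs \<subseteq> \<Sigma>" "u = T xs"
  using assms carrier_eq by auto

lemma trace_of_carrier [simp]: "set xs \<subseteq> \<Sigma> \<Longrightarrow> T xs \<in> carrier M"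
  by (simp add: carrier_eq)

lemma empty_trace_eq: "\<epsilon> = T []"
  by (simp add: trace_monoid_def)

lemma mult_trace_of:
  assumes "set xs \<subseteq> \<Sigma>" "set ys \<subseteq> \<Sigma>"
  shows "T xs \<odot> T ys = T (xs @ ys)"
proof -
  have "T (xs' @ ys') = T (xs @ ys)" if "xs' \<in> T xs" "ys' \<in> T ys" for xs' ys'
  proof -
    have "trace_eq (xs @ ys) (xs' @ ys')"
      using that by (intro trace_cong.append) (simp_all add: mem_trace_of_iff)
    then show ?thesis using trace_eq_letters trace_of_eq_iff_trace_eq by metis
  qed
  moreover have "xs \<in> T xs" "ys \<in> T ys"
    using assms by (simp_all add: mem_trace_of_iff trace_eq_refl)
  ultimately have "(\<Union>xs'\<in>T xs. \<Union>ys'\<in>T ys. T (xs' @ ys')) = T (xs @ ys)" by blast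
  then show ?thesis by (simp add: trace_monoid_def)
qed

sublocale traces: monoid_cancel M
proof (intro monoid.monoid_cancelI monoidI)
  fix u v w assume "u \<in> carrier M" "v \<in> carrier M" "w \<in> carrier M"
  then obtain xs ys zs where words: "set xs \<subseteq> \<Sigma>" "set ys \<subseteq> \<Sigma>" "set zs \<subseteq> \<Sigma>"
    and uvw: "u = T xs" "v = T ys" "w = T zs"
    using carrierE by metis
  show "u \<odot> v \<odot> w = u \<odot> (v \<odot> w)" using words by (simp add: uvw mult_trace_of)
  show "u = v" if "w \<odot> u = w \<odot> v"
    using that words by (simp add: uvw mult_trace_of trace_of_eq_iff_proj_eq)
  show "u = v" if "u \<odot> w = v \<odot> w"
    using that words by (simp add: uvw mult_trace_of trace_of_eq_iff_proj_eq)
qed (auto elim!: carrierE simp: mult_trace_of empty_trace_eq)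

text \<open>As classical rules, these make the provers enumerate cofactors.\<close>

declare dividesI' [rule del] dividesE [rule del]

lemma trace_of_divides_iff_proj_prefix:
  assumes "set xs \<subseteq> \<Sigma>" "set ys \<subseteq> \<Sigma>"
  shows "T xs \<preceq> T ys \<longleftrightarrow> (\<forall>a b. (a, b) \<in> D \<longrightarrow> prefix (proj a b xs) (proj a b ys))"
proof
  assume "T xs \<preceq> T ys"
  then obtain zs where "set zs \<subseteq> \<Sigma>" "T ys = T (xs @ zs)"
    using assms(1) by (auto simp: mult_trace_of elim!: dividesE carrierE)
  then show "\<forall>a b. (a, b) \<in> D \<longrightarrow> prefix (proj a b xs) (proj a b ys)"
    using assms by (simp add: trace_of_eq_iff_proj_eq)
next
  assume "\<forall>a b. (a, b) \<in> D \<longrightarrow> prefix (proj a b xs) (proj a b ys)"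
  then obtain zs where "set zs \<subseteq> \<Sigma>" "trace_eq (xs @ zs) ys"
    using trace_eq_append_if_proj_prefix assms by blast
  then have "T ys = T xs \<odot> T zs"
    using assms by (simp add: mult_trace_of trace_of_eq_iff_trace_eq trace_cong.sym)
  then show "T xs \<preceq> T ys" using \<open>set zs \<subseteq> \<Sigma>\<close> by (intro dividesI[of "T zs"]) simp_all
qed

lemma divides_antisym:
  assumes "u \<in> carrier M" "v \<in> carrier M" "u \<preceq> v" "v \<preceq> u"
  shows "u = v"
proof -
  obtain xs ys where "set xs \<subseteq> \<Sigma>" "u = T xs" "set ys \<subseteq> \<Sigma>" "v = T ys"
    using assms(1,2) carrierE by metis
  then show ?thesis
    using assms(3,4)
    by (simp add: trace_of_divides_iff_proj_prefix trace_of_eq_iff_proj_eq prefix_order.antisym)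
qed

section \<open>Letter counts and least common multiples\<close>

lemma the_elem_image_trace_of:
  assumes "set xs \<subseteq> \<Sigma>" and "\<And>ys. mset ys = mset xs \<Longrightarrow> f ys = f xs"
  shows "the_elem (f ` T xs) = f xs"
proof -
  have "xs \<in> T xs" using assms(1) by (simp add: mem_trace_of_iff trace_eq_refl)
  moreover have "f ys = f xs" if "ys \<in> T xs" for ys
    using that assms(2) trace_eq_mset by (metis mem_trace_of_iff)
  ultimately have "f ` T xs = {f xs}" by blast
  then show ?thesis by simp
qed

definition letter_count :: "'a list set \<Rightarrow> 'a \<Rightarrow> nat" where
  "letter_count u a = the_elem ((\<lambda>xs. count_list xs a) ` u)"

lemma letter_count_trace_of [simp]: "set xs \<subseteq> \<Sigma> \<Longrightarrow> letter_count (T xs) a = count_list xs a"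
  unfolding letter_count_def by (rule the_elem_image_trace_of) (metis count_mset)+

lemma letter_count_one [simp]: "letter_count \<epsilon> a = 0"
  by (simp add: empty_trace_eq)

lemma letter_count_mult [simp]:
  "u \<in> carrier M \<Longrightarrow> v \<in> carrier M \<Longrightarrow> letter_count (u \<odot> v) a = letter_count u a + letter_count v a"
  by (auto elim!: carrierE simp: mult_trace_of)

lemma letter_count_mono:
  "u \<in> carrier M \<Longrightarrow> u \<preceq> v \<Longrightarrow> letter_count u a \<le> letter_count v a"
  by (auto elim: dividesE)

lemma letter_count_outside: "u \<in> carrier M \<Longrightarrow> a \<notin> \<Sigma> \<Longrightarrow> letter_count u a = 0"
  by (auto elim!: carrierE simp: count_list_0_iff)

definition letters :: "'a list set \<Rightarrow> 'a set" where
  "letters u = {a. letter_count u a \<noteq> 0}"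

lemma letters_trace_of [simp]: "set xs \<subseteq> \<Sigma> \<Longrightarrow> letters (T xs) = set xs"
  by (auto simp: letters_def count_list_0_iff)

lemma letters_mult [simp]:
  "u \<in> carrier M \<Longrightarrow> v \<in> carrier M \<Longrightarrow> letters (u \<odot> v) = letters u \<union> letters v"
  by (auto simp: letters_def)

lemma letters_subset: "u \<in> carrier M \<Longrightarrow> letters u \<subseteq> \<Sigma>"
  by (auto elim!: carrierE)

lemma trace_length_trace_of: "set xs \<subseteq> \<Sigma> \<Longrightarrow> trace_length (T xs) = length xs"
  unfolding trace_length_def by (rule the_elem_image_trace_of) (auto dest: mset_eq_length)

lemma trace_length_eq_sum: "u \<in> carrier M \<Longrightarrow> trace_length u = (\<Sum>a\<in>\<Sigma>. letter_count u a)"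
  by (auto elim!: carrierE simp: trace_length_trace_of sum_count_set finite_letters)

lemma letter_count_le_trace_length: "u \<in> carrier M \<Longrightarrow> letter_count u a \<le> trace_length u"
  by (auto elim!: carrierE simp: trace_length_trace_of count_le_length)

lemma trace_length_mono: "u \<in> carrier M \<Longrightarrow> v \<in> carrier M \<Longrightarrow> u \<preceq> v \<Longrightarrow> trace_length u \<le> trace_length v"
  by (simp add: trace_length_eq_sum letter_count_mono sum_mono)

lemma trace_induct [consumes 1, case_names empty snoc]:
  assumes "u \<in> carrier M" "P \<epsilon>"
    and "\<And>u a. u \<in> carrier M \<Longrightarrow> a \<in> \<Sigma> \<Longrightarrow> P u \<Longrightarrow> P (u \<odot> T [a])"
  shows "P u"
proof -
  obtain xs where "set xs \<subseteq> \<Sigma>" "u = T xs" using assms(1) carrierE by metis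
  moreover have "P (T xs)" if "set xs \<subseteq> \<Sigma>" for xs
    using that
  proof (induction xs rule: rev_induct)
    case Nil
    show ?case using assms(2) by (simp add: empty_trace_eq)
  next
    case (snoc a xs)
    then show ?case using assms(3)[of "T xs" a] by (simp add: mult_trace_of)
  qed
  ultimately show ?thesis by simp
qed

text \<open>For each pair of dependent letters the projections of \<open>u\<close> and \<open>v\<close> are prefixes of the
  projection of \<open>x\<close>, so it suffices to compare their lengths.\<close>

lemma divides_iff_letter_count_le:
  assumes "u \<in> carrier M" "v \<in> carrier M" "x \<in> carrier M" "u \<preceq> x" "v \<preceq> x"
  shows "u \<preceq> v \<longleftrightarrow> (\<forall>a. letter_count u a \<le> letter_count v a)"
proof
  assume count_le: "\<forall>a. letter_count u a \<le> letter_count v a"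
  obtain xs ys zs where words: "set xs \<subseteq> \<Sigma>" "set ys \<subseteq> \<Sigma>" "set zs \<subseteq> \<Sigma>"
    and eqs: "u = T xs" "v = T ys" "x = T zs"
    using assms(1-3) carrierE by metis
  have "prefix (proj a b xs) (proj a b ys)" if "(a, b) \<in> D" for a b
  proof (rule prefix_length_prefix)
    show "prefix (proj a b xs) (proj a b zs)" "prefix (proj a b ys) (proj a b zs)"
      using assms(4,5) that words by (simp_all add: eqs trace_of_divides_iff_proj_prefix)
    show "length (proj a b xs) \<le> length (proj a b ys)"
      using count_le words by (simp add: eqs length_proj add_mono)
  qed
  then show "u \<preceq> v" using words by (simp add: eqs trace_of_divides_iff_proj_prefix)
qed (use assms letter_count_mono in blast)

lemma divides_trace_length_eq:
  assumes "u \<in> carrier M" "v \<in> carrier M" "u \<preceq> v" "trace_length v \<le> trace_length u"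
  shows "u = v"
proof -
  obtain w where w: "w \<in> carrier M" "v = u \<odot> w" using assms(3) by (auto elim: dividesE)
  then have "sum (letter_count w) \<Sigma> = 0"
    using assms by (simp add: trace_length_eq_sum sum.distrib)
  then have "letter_count w a = 0" for a
    using letter_count_outside[OF w(1)] finite_letters by (cases "a \<in> \<Sigma>") auto
  then have "v \<preceq> u"
    using divides_iff_letter_count_le[of v u v] assms w by simp
  then show ?thesis using divides_antisym assms by blast
qed

lemma divides_neq_letter:
  assumes "u \<in> carrier M" "u \<preceq> v" "u \<noteq> v"
  obtains a where "a \<in> \<Sigma>" "u \<odot> T [a] \<preceq> v"
proof -
  obtain w where w: "w \<in> carrier M" "v = u \<odot> w" using assms(2) by (auto elim: dividesE)
  obtain ys where ys: "set ys \<subseteq> \<Sigma>" "w = T ys" using w(1) carrierE by metis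
  have "w \<noteq> \<epsilon>" using assms(1,3) w(2) by (metis traces.r_one)
  then have "ys \<noteq> []" using ys(2) empty_trace_eq by metis
  then obtain a zs where azs: "a \<in> \<Sigma>" "set zs \<subseteq> \<Sigma>" "ys = a # zs" using ys(1) by (cases ys) auto
  then have "v = u \<odot> T [a] \<odot> T zs"
    using w(2) ys(2) assms(1) by (simp add: mult_trace_of traces.m_assoc)
  then have "u \<odot> T [a] \<preceq> v" using azs(2) by (simp add: traces.divides_mult)
  with azs(1) show thesis by (rule that)
qed

lemma letter_divides_iff_proj_prefix:
  assumes "a \<in> \<Sigma>" "set xs \<subseteq> \<Sigma>"
  shows "T [a] \<preceq> T xs \<longleftrightarrow> (\<forall>b. (a, b) \<in> D \<longrightarrow> prefix [a] (proj a b xs))"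
proof
  assume "T [a] \<preceq> T xs"
  then have "\<forall>b c. (b, c) \<in> D \<longrightarrow> prefix (proj b c [a]) (proj b c xs)"
    using assms trace_of_divides_iff_proj_prefix[of "[a]" xs] by simp
  then show "\<forall>b. (a, b) \<in> D \<longrightarrow> prefix [a] (proj a b xs)" by (auto dest: spec[of _ a])
next
  assume first: "\<forall>b. (a, b) \<in> D \<longrightarrow> prefix [a] (proj a b xs)"
  then have "prefix (proj b c [a]) (proj b c xs)" if "(b, c) \<in> D" for b c
    using that dep_commute[of b c] by (cases "a = b") (auto simp: proj_commute[of b c])
  then show "T [a] \<preceq> T xs" using assms by (simp add: trace_of_divides_iff_proj_prefix)
qed

lemma proj_eq_Nil_if_letter_divides_multiple:
  assumes "set xs \<subseteq> \<Sigma>" "set ys \<subseteq> \<Sigma>" "(a, b) \<in> D"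
    and "T xs \<preceq> T ys" "T [a] \<preceq> T ys" "a \<notin> set xs"
  shows "proj a b xs = []"
proof (rule ccontr)
  assume "proj a b xs \<noteq> []"
  then have "hd (proj a b xs) \<noteq> a"
    using \<open>a \<notin> set xs\<close> hd_in_set by (fastforce simp: set_proj)
  moreover have "prefix (proj a b xs) (proj a b ys)"
    using assms(1-4) by (simp add: trace_of_divides_iff_proj_prefix)
  moreover have "prefix [a] (proj a b ys)"
    using assms(2,3,5) dep_letters by (simp add: letter_divides_iff_proj_prefix)
  ultimately show False
    using \<open>proj a b xs \<noteq> []\<close> by (cases "proj a b xs") (auto simp: prefix_def)
qed

lemma mult_letter_divides:
  assumes "u \<in> carrier M" "x \<in> carrier M" "a \<in> \<Sigma>" "u \<preceq> x" "T [a] \<preceq> x" "a \<notin> letters u"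
  shows "u \<odot> T [a] \<preceq> x" "letters u \<subseteq> {b. (b, a) \<in> I}"
proof -
  obtain xs ys where words: "set xs \<subseteq> \<Sigma>" "set ys \<subseteq> \<Sigma>" and eqs: "u = T xs" "x = T ys"
    using assms(1,2) carrierE by metis
  have proj_Nil: "proj a b xs = []" if "(a, b) \<in> D" for b
    using assms(4-6) words that
    by (intro proj_eq_Nil_if_letter_divides_multiple[of xs ys]) (simp_all add: eqs)
  then have prefix_a: "prefix (proj a b (xs @ [a])) (proj a b ys)" if "(a, b) \<in> D" for b
    using that assms(3,5) words by (simp add: eqs letter_divides_iff_proj_prefix)
  have "prefix (proj b c (xs @ [a])) (proj b c ys)" if "(b, c) \<in> D" for b c
  proof (cases "a = b \<or> a = c")
    case True
    then show ?thesis using prefix_a that dep_commute proj_commute by metis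
  next
    case False
    then show ?thesis using that assms(4) words by (simp add: eqs trace_of_divides_iff_proj_prefix)
  qed
  then show "u \<odot> T [a] \<preceq> x"
    using assms(3) words by (simp add: eqs mult_trace_of trace_of_divides_iff_proj_prefix)
  show "letters u \<subseteq> {b. (b, a) \<in> I}"
  proof
    fix b assume "b \<in> letters u"
    then have b: "b \<in> set xs" using words by (simp add: eqs)
    then have "(a, b) \<notin> D" using proj_Nil by (auto simp: proj_eq_Nil_iff)
    then show "b \<in> {b. (b, a) \<in> I}"
      using b words assms(3) by (auto simp: dep_iff_not_indep indep_commute[of b a])
  qed
qed

text \<open>The least common multiple is built along \<open>v\<close>: a letter of \<open>v\<close> is appended unless \<open>u\<close>
  already accounts for it.\<close>

definition letterwise_lcm :: "'a list set \<Rightarrow> 'a list set \<Rightarrow> 'a list set \<Rightarrow> bool" where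
  "letterwise_lcm w u v \<longleftrightarrow> w \<in> carrier M \<and> w lcmof\<^bsub>M\<^esub> u v \<and>
    (\<forall>a. letter_count w a = max (letter_count u a) (letter_count v a))"

context
  fixes u v w x a
  assumes lcm: "letterwise_lcm w u v" and carrier: "u \<in> carrier M" "v \<in> carrier M" "a \<in> \<Sigma>"
    and x: "x \<in> carrier M" "u \<preceq> x" "v \<odot> T [a] \<preceq> x"
begin

lemma letterwise_lcm_divides:
  assumes "y \<in> carrier M" "u \<preceq> y" "v \<odot> T [a] \<preceq> y"
  shows "w \<preceq> y"
proof -
  have "v \<preceq> v \<odot> T [a]" using carrier by (simp add: traces.divides_mult)
  from this assms(3) carrier(2) have "v \<preceq> y" by (rule traces.divides_trans)
  then show ?thesis using lcm assms(1,2) by (simp add: letterwise_lcm_def islcm_def)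
qed

lemma letterwise_lcm_absorb_letter:
  assumes "letter_count v a < letter_count u a"
  shows "letterwise_lcm w u (v \<odot> T [a])"
proof -
  have count: "letter_count w b = max (letter_count u b) (letter_count (v \<odot> T [a]) b)" for b
    using lcm assms carrier by (auto simp: letterwise_lcm_def)
  then have "v \<odot> T [a] \<preceq> w"
    using divides_iff_letter_count_le[of "v \<odot> T [a]" w x] letterwise_lcm_divides lcm carrier x
    by (auto simp: letterwise_lcm_def)
  then show ?thesis
    using lcm letterwise_lcm_divides count by (simp add: letterwise_lcm_def islcm_def)
qed

lemma letterwise_lcm_append_letter:
  assumes "letter_count u a \<le> letter_count v a"
  shows "letterwise_lcm (w \<odot> T [a]) u (v \<odot> T [a])"
proof -
  have w: "w \<in> carrier M" "u \<preceq> w" "v \<preceq> w"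
    using lcm by (simp_all add: letterwise_lcm_def islcm_def)
  have count: "letter_count (w \<odot> T [a]) b =
      max (letter_count u b) (letter_count (v \<odot> T [a]) b)" for b
    using lcm assms carrier by (auto simp: letterwise_lcm_def)
  obtain z where z: "z \<in> carrier M" "w = v \<odot> z" using w(3) by (auto elim: dividesE)
  have "letter_count w a = letter_count v a" using lcm assms by (simp add: letterwise_lcm_def)
  then have "a \<notin> letters z" using z carrier by (simp add: letters_def)
  have least: "w \<odot> T [a] \<preceq> y" if y: "y \<in> carrier M" "u \<preceq> y" "v \<odot> T [a] \<preceq> y" for y
  proof -
    obtain r where r: "r \<in> carrier M" "y = v \<odot> T [a] \<odot> r" using y(3) by (auto elim: dividesE)
    then have "z \<preceq> T [a] \<odot> r" "T [a] \<preceq> T [a] \<odot> r"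
      using letterwise_lcm_divides[OF y] z carrier
      by (simp_all add: traces.m_assoc traces.divides_mult)
    then have "z \<odot> T [a] \<preceq> T [a] \<odot> r"
      using mult_letter_divides(1) z r carrier \<open>a \<notin> letters z\<close> by simp
    then show ?thesis using r z carrier by (simp add: traces.m_assoc)
  qed
  have "v \<odot> T [a] \<preceq> w \<odot> T [a]"
    using divides_iff_letter_count_le[of "v \<odot> T [a]" "w \<odot> T [a]" x] least[OF x] count w x carrier
    by auto
  moreover have "u \<preceq> w \<odot> T [a]" using w carrier by (simp add: traces.divides_prod_r)
  ultimately show ?thesis
    using least count w carrier by (simp add: letterwise_lcm_def islcm_def)
qed

end

lemma letterwise_lcm_exists:
  assumes "u \<in> carrier M" "v \<in> carrier M" "x \<in> carrier M" "u \<preceq> x" "v \<preceq> x"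
  shows "\<exists>w. letterwise_lcm w u v"
  using assms(2,5)
proof (induction v rule: trace_induct)
  case empty
  show ?case
    using assms(1)
    by (intro exI[of _ u]) (simp add: letterwise_lcm_def islcm_def traces.one_divides)
next
  case (snoc v a)
  have "v \<preceq> v \<odot> T [a]" using snoc.hyps by (simp add: traces.divides_mult)
  from this snoc.prems snoc.hyps(1) have "v \<preceq> x" by (rule traces.divides_trans)
  then obtain w where lcm: "letterwise_lcm w u v" using snoc.IH by blast
  show ?case
  proof (cases "letter_count v a < letter_count u a")
    case True
    then show ?thesis
      using letterwise_lcm_absorb_letter[OF lcm assms(1) snoc.hyps assms(3,4) snoc.prems] by blast
  next
    case False
    then show ?thesis
      using letterwise_lcm_append_letter[OF lcm assms(1) snoc.hyps assms(3,4) snoc.prems] by auto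
  qed
qed

section \<open>Truncation\<close>

definition bounded_traces :: "('a \<Rightarrow> nat) \<Rightarrow> 'a list set set" where
  "bounded_traces K = {u \<in> carrier M. \<forall>a. letter_count u a \<le> K a}"

lemma bounded_traces_carrier: "u \<in> bounded_traces K \<Longrightarrow> u \<in> carrier M"
  by (simp add: bounded_traces_def)

lemma one_bounded_traces: "\<epsilon> \<in> bounded_traces K"
  by (simp add: bounded_traces_def)

lemma finite_bounded_traces: "finite (bounded_traces K)"
proof (rule finite_subset)
  show "bounded_traces K \<subseteq> T ` {xs. set xs \<subseteq> \<Sigma> \<and> length xs \<le> sum K \<Sigma>}"
  proof
    fix u assume u: "u \<in> bounded_traces K"
    then obtain xs where xs: "set xs \<subseteq> \<Sigma>" "u = T xs" using bounded_traces_carrier carrierE by metis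
    have "length xs = (\<Sum>a\<in>\<Sigma>. letter_count u a)"
      using trace_length_eq_sum bounded_traces_carrier[OF u] trace_length_trace_of xs by simp
    also have "\<dots> \<le> sum K \<Sigma>" using u by (intro sum_mono) (simp add: bounded_traces_def)
    finally show "u \<in> T ` {xs. set xs \<subseteq> \<Sigma> \<and> length xs \<le> sum K \<Sigma>}" using xs by blast
  qed
  show "finite (T ` {xs. set xs \<subseteq> \<Sigma> \<and> length xs \<le> sum K \<Sigma>})"
    by (intro finite_imageI finite_lists_length_le finite_letters)
qed

lemma greatest_bounded_divisor_exists:
  assumes x: "x \<in> carrier M"
  shows "\<exists>y\<in>bounded_traces K. y \<preceq> x \<and> (\<forall>u\<in>bounded_traces K. u \<preceq> x \<longrightarrow> u \<preceq> y)"
proof -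
  let ?S = "{u \<in> bounded_traces K. u \<preceq> x}"
  have "finite ?S" "?S \<noteq> {}"
    using finite_bounded_traces one_bounded_traces traces.one_divides[OF x] by auto
  then obtain y where y: "y \<in> ?S" and "Max (trace_length ` ?S) = trace_length y"
    by (rule obtains_MAX)
  then have longest: "trace_length u \<le> trace_length y" if "u \<in> ?S" for u
    using that Max_ge[of "trace_length ` ?S"] \<open>finite ?S\<close> by auto
  have "u \<preceq> y" if u: "u \<in> ?S" for u
  proof -
    have uy: "u \<in> carrier M" "y \<in> carrier M" using u y bounded_traces_carrier by auto
    then obtain w where w: "letterwise_lcm w u y"
      using letterwise_lcm_exists[of u y x] x u y by auto
    then have "w \<in> ?S"
      using u y x by (auto simp: bounded_traces_def letterwise_lcm_def islcm_def)
    then have "y = w"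
      using divides_trace_length_eq[of y w] longest w uy by (simp add: letterwise_lcm_def islcm_def)
    then show ?thesis using w by (simp add: letterwise_lcm_def islcm_def)
  qed
  then show ?thesis using y by blast
qed

definition trunc :: "('a \<Rightarrow> nat) \<Rightarrow> 'a list set \<Rightarrow> 'a list set" where
  "trunc K x =
    (SOME y. y \<in> bounded_traces K \<and> y \<preceq> x \<and> (\<forall>u\<in>bounded_traces K. u \<preceq> x \<longrightarrow> u \<preceq> y))"

lemma
  assumes "x \<in> carrier M"
  shows trunc_bounded_traces: "trunc K x \<in> bounded_traces K"
    and trunc_divides: "trunc K x \<preceq> x"
    and divides_trunc: "u \<in> bounded_traces K \<Longrightarrow> u \<preceq> x \<Longrightarrow> u \<preceq> trunc K x"
proof -
  have "trunc K x \<in> bounded_traces K \<and> trunc K x \<preceq> x \<and>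
      (\<forall>u\<in>bounded_traces K. u \<preceq> x \<longrightarrow> u \<preceq> trunc K x)"
    unfolding trunc_def
    by (rule someI_ex) (use greatest_bounded_divisor_exists[OF assms, of K] in blast)
  then show "trunc K x \<in> bounded_traces K" "trunc K x \<preceq> x"
    "u \<in> bounded_traces K \<Longrightarrow> u \<preceq> x \<Longrightarrow> u \<preceq> trunc K x" by blast+
qed

definition free_letters :: "('a \<Rightarrow> nat) \<Rightarrow> 'a list set \<Rightarrow> 'a set" where
  "free_letters K u = {a \<in> \<Sigma>. letter_count u a < K a}"

lemma mult_letter_bounded_traces_iff:
  assumes "u \<in> bounded_traces K" "a \<in> \<Sigma>"
  shows "u \<odot> T [a] \<in> bounded_traces K \<longleftrightarrow> a \<in> free_letters K u"
  using assms by (auto simp: bounded_traces_def free_letters_def Suc_le_eq dest: spec[of _ a])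

lemma trunc_mult_free_letter_not_divides:
  assumes x: "x \<in> carrier M" and a: "a \<in> free_letters K (trunc K x)"
  shows "\<not> trunc K x \<odot> T [a] \<preceq> x"
proof
  have y: "trunc K x \<in> carrier M" and "a \<in> \<Sigma>"
    using trunc_bounded_traces[OF x] bounded_traces_carrier a by (auto simp: free_letters_def)
  assume "trunc K x \<odot> T [a] \<preceq> x"
  then have "trunc K x \<odot> T [a] \<preceq> trunc K x"
    using divides_trunc[OF x] mult_letter_bounded_traces_iff[OF trunc_bounded_traces[OF x]] a
      \<open>a \<in> \<Sigma>\<close> by blast
  then show False
    using letter_count_mono[of "trunc K x \<odot> T [a]" "trunc K x" a] y \<open>a \<in> \<Sigma>\<close> by simp
qed

lemma trunc_eqI:
  assumes x: "x \<in> carrier M" and y: "y \<in> bounded_traces K" "y \<preceq> x"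
    and maximal: "\<And>a. a \<in> free_letters K y \<Longrightarrow> \<not> y \<odot> T [a] \<preceq> x"
  shows "trunc K x = y"
proof (rule ccontr)
  have y_carrier: "y \<in> carrier M" using y(1) by (rule bounded_traces_carrier)
  assume "trunc K x \<noteq> y"
  then obtain a where a: "a \<in> \<Sigma>" "y \<odot> T [a] \<preceq> trunc K x"
    using divides_neq_letter[OF y_carrier divides_trunc[OF x y]] by metis
  have "letter_count (y \<odot> T [a]) b \<le> K b" for b
    using letter_count_mono[OF _ a(2), of b] trunc_bounded_traces[OF x, of K] y_carrier a(1)
    by (auto simp: bounded_traces_def intro: order_trans)
  then have "a \<in> free_letters K y"
    using mult_letter_bounded_traces_iff[OF y(1) a(1)] y_carrier a(1)
    by (simp add: bounded_traces_def)
  moreover have "y \<odot> T [a] \<preceq> x"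
    using traces.divides_trans[OF a(2) trunc_divides[OF x]] y_carrier a(1) by simp
  ultimately show False using maximal by blast
qed

lemma trunc_eq_iff:
  assumes "x \<in> carrier M" "y \<in> bounded_traces K"
  shows "trunc K x = y \<longleftrightarrow> y \<preceq> x \<and> (\<forall>a\<in>free_letters K y. \<not> y \<odot> T [a] \<preceq> x)"
  using assms trunc_divides trunc_mult_free_letter_not_divides trunc_eqI by metis

end

section \<open>Inclusion-exclusion\<close>

lemma sum_Pow_neg_one_power_card:
  assumes "finite S"
  shows "(\<Sum>X\<in>Pow S. (- 1) ^ card X) = (if S = {} then 1 else (0 :: 'b :: comm_ring_1))"
  using prod_diff_conv_sum[OF assms, of "\<lambda>_. 1 :: 'b" "\<lambda>_. 1"] assms
  by (auto simp: card_gt_0_iff power_0_left)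

lemma (in finite_measure) Incl_Excl_measure: "Incl_Excl (\<lambda>A. A \<in> sets M) (measure M)"
  by unfold_locales (auto simp: disjnt_def finite_measure_Union)

lemma (in finite_measure) measure_Diff_UN_eq_sum:
  assumes "finite N" and X: "X \<in> sets M" and A: "\<And>a. a \<in> N \<Longrightarrow> A a \<in> sets M" "\<And>a. a \<in> N \<Longrightarrow> A a \<subseteq> X"
  shows "measure M (X - (\<Union>a\<in>N. A a)) = (\<Sum>d\<in>Pow N. (- 1) ^ card d * measure M (X \<inter> (\<Inter>a\<in>d. A a)))"
proof -
  let ?g = "\<lambda>d. (- 1) ^ card d * measure M (X \<inter> (\<Inter>a\<in>d. A a))"
  have "measure M (\<Union>a\<in>N. A a) =
      (\<Sum>d | d \<subseteq> N \<and> d \<noteq> {}. (- 1) ^ (card d + 1) * measure M (\<Inter>a\<in>d. A a))"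
    using assms by (intro Incl_Excl.restricted_indexed[OF Incl_Excl_measure])
  also have "\<dots> = (\<Sum>d\<in>Pow N - {{}}. - ?g d)"
  proof (rule sum.cong)
    fix d assume "d \<in> Pow N - {{}}"
    then have "X \<inter> (\<Inter>a\<in>d. A a) = (\<Inter>a\<in>d. A a)" using A(2) by blast
    then show "(- 1) ^ (card d + 1) * measure M (\<Inter>a\<in>d. A a) = - ?g d" by simp
  qed auto
  finally have "measure M (\<Union>a\<in>N. A a) = - (\<Sum>d\<in>Pow N - {{}}. ?g d)"
    by (simp add: sum_negf)
  moreover have "measure M (X - (\<Union>a\<in>N. A a)) = measure M X - measure M (\<Union>a\<in>N. A a)"
    using assms by (intro finite_measure_Diff) auto
  ultimately show ?thesis
    using \<open>finite N\<close> sum.remove[of "Pow N" "{}" ?g] by simp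
qed

context independence_pair
begin

section \<open>Cliques\<close>

definition clique_set :: "'a set \<Rightarrow> bool" where
  "clique_set d \<longleftrightarrow> d \<subseteq> \<Sigma> \<and> pairwise (\<lambda>a b. (a, b) \<in> I) d"

definition first_letters :: "'a list set \<Rightarrow> 'a set" where
  "first_letters x = {a \<in> \<Sigma>. T [a] \<preceq> x}"

definition commuting_letters :: "'a set \<Rightarrow> 'a set" where
  "commuting_letters c = {a \<in> \<Sigma>. \<forall>x\<in>c. (a, x) \<in> I}"

lemma clique_set_empty [simp]: "clique_set {}"
  by (simp add: clique_set_def)

lemma clique_set_subset: "clique_set d \<Longrightarrow> c \<subseteq> d \<Longrightarrow> clique_set c"
  by (auto simp: clique_set_def intro: pairwise_subset)

lemma finite_clique_set: "clique_set d \<Longrightarrow> finite d"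
  using finite_letters finite_subset by (auto simp: clique_set_def)

lemma finite_clique_sets: "finite {d. clique_set d \<and> P d}"
  by (rule finite_subset[of _ "Pow \<Sigma>"]) (auto simp: clique_set_def finite_letters)

lemma clique_set_Un_iff:
  assumes "clique_set c" "c \<inter> d = {}"
  shows "clique_set (c \<union> d) \<longleftrightarrow> clique_set d \<and> d \<subseteq> commuting_letters c"
proof -
  have "pairwise (\<lambda>a b. (a, b) \<in> I) (c \<union> d) \<longleftrightarrow>
      pairwise (\<lambda>a b. (a, b) \<in> I) c \<and> pairwise (\<lambda>a b. (a, b) \<in> I) d \<and> (\<forall>a\<in>d. \<forall>b\<in>c. (a, b) \<in> I)"
  proof -
    have "(\<forall>a\<in>c. \<forall>b\<in>d. a \<noteq> b \<longrightarrow> (a, b) \<in> I) \<longleftrightarrow> (\<forall>a\<in>d. \<forall>b\<in>c. (a, b) \<in> I)"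
      "(\<forall>a\<in>d. \<forall>b\<in>c. a \<noteq> b \<longrightarrow> (a, b) \<in> I) \<longleftrightarrow> (\<forall>a\<in>d. \<forall>b\<in>c. (a, b) \<in> I)"
      using assms(2) by (metis indep_commute disjoint_iff)+
    then show ?thesis unfolding pairwise_def ball_Un ball_conj_distrib by argo
  qed
  then show ?thesis using assms(1) by (auto simp: clique_set_def commuting_letters_def)
qed

lemma clique_set_first_letters:
  assumes "x \<in> carrier M"
  shows "clique_set (first_letters x)"
  unfolding clique_set_def
proof (intro conjI pairwiseI)
  fix a b assume "a \<in> first_letters x" "b \<in> first_letters x" "a \<noteq> b"
  then show "(a, b) \<in> I"
    using mult_letter_divides(2)[of "T [a]" x b] assms by (auto simp: first_letters_def)
qed (auto simp: first_letters_def)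

lemma proj_clique_word:
  assumes "clique_set (set xs)" "distinct xs" "(a, b) \<in> D"
  shows "proj a b xs = (if a \<in> set xs then [a] else if b \<in> set xs then [b] else [])"
  using assms(1,2)
proof (induction xs)
  case (Cons x xs)
  have "\<not> (x = a \<and> b \<in> set xs)" "\<not> (x = b \<and> a \<in> set xs)"
    using Cons.prems assms(3) dep_commute[of a b]
    by (auto simp: clique_set_def pairwise_insert D_def)
  moreover have "clique_set (set xs)" using Cons.prems(1) by (rule clique_set_subset) auto
  ultimately show ?case using Cons by (auto simp: proj_eq_Nil_iff)
qed auto

definition clique_trace :: "'a set \<Rightarrow> 'a list set" where
  "clique_trace d = T (SOME xs. set xs = d \<and> distinct xs)"

lemma clique_trace_set:
  assumes "clique_set (set xs)" "distinct xs"
  shows "clique_trace (set xs) = T xs"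
proof -
  let ?ys = "SOME ys. set ys = set xs \<and> distinct ys"
  have ys: "set ?ys = set xs \<and> distinct ?ys" by (rule someI[of _ xs]) (simp add: assms(2))
  have "proj a b ?ys = proj a b xs" if "(a, b) \<in> D" for a b
    using assms ys proj_clique_word[OF _ _ that] by simp
  then show ?thesis
    using assms(1) ys unfolding clique_trace_def
    by (simp add: clique_set_def trace_of_eq_iff_proj_eq)
qed

lemma clique_wordE:
  assumes "clique_set d"
  obtains xs where "set xs = d" "distinct xs" "set xs \<subseteq> \<Sigma>" "clique_trace d = T xs"
  using assms finite_distinct_list[OF finite_clique_set] clique_trace_set
  by (metis clique_set_def)

lemma clique_trace_carrier [simp]: "clique_set d \<Longrightarrow> clique_trace d \<in> carrier M"
  by (metis clique_wordE trace_of_carrier)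

lemma clique_trace_empty [simp]: "clique_trace {} = \<epsilon>"
  using clique_trace_set[of "[]"] by (simp add: empty_trace_eq)

lemma clique_trace_singleton: "a \<in> \<Sigma> \<Longrightarrow> clique_trace {a} = T [a]"
  using clique_trace_set[of "[a]"] by (simp add: clique_set_def)

lemma clique_trace_Un:
  assumes "clique_set (c \<union> d)" "c \<inter> d = {}"
  shows "clique_trace (c \<union> d) = clique_trace c \<odot> clique_trace d"
proof -
  have "clique_set c" "clique_set d" using assms(1) clique_set_subset by blast+
  then obtain xs ys where "set xs = c" "distinct xs" "clique_trace c = T xs"
    and "set ys = d" "distinct ys" "clique_trace d = T ys"
    using clique_wordE by metis
  then show ?thesis
    using assms clique_trace_set[of "xs @ ys"] by (simp add: mult_trace_of clique_set_def)
qed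

lemma letter_count_clique_trace:
  "clique_set d \<Longrightarrow> letter_count (clique_trace d) a = (if a \<in> d then 1 else 0)"
  by (erule clique_wordE) (auto simp: distinct_count_atmost_1 simp flip: count_mset)

lemma letters_clique_trace: "clique_set d \<Longrightarrow> letters (clique_trace d) = d"
  by (simp add: letters_def letter_count_clique_trace)

lemma inj_on_clique_trace: "inj_on clique_trace {d. clique_set d}"
  by (rule inj_onI) (metis letters_clique_trace mem_Collect_eq)

lemma trace_length_clique_trace: "clique_set d \<Longrightarrow> trace_length (clique_trace d) = card d"
  by (metis clique_wordE trace_length_trace_of distinct_card)

lemma letter_divides_clique_trace:
  assumes "clique_set d" "a \<in> d"
  shows "T [a] \<preceq> clique_trace d"
proof -
  have "a \<in> \<Sigma>" "clique_set (d - {a})"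
    using assms clique_set_subset[OF assms(1)] by (auto simp: clique_set_def)
  moreover have "clique_trace d = T [a] \<odot> clique_trace (d - {a})"
    using clique_trace_Un[of "{a}" "d - {a}"] assms \<open>a \<in> \<Sigma>\<close>
    by (simp add: insert_absorb clique_trace_singleton)
  ultimately show ?thesis by (simp add: traces.divides_mult)
qed

lemma clique_trace_divides_iff:
  assumes "x \<in> carrier M" "clique_set d"
  shows "clique_trace d \<preceq> x \<longleftrightarrow> d \<subseteq> first_letters x"
proof
  assume dx: "clique_trace d \<preceq> x"
  show "d \<subseteq> first_letters x"
  proof
    fix a assume a: "a \<in> d"
    then have "a \<in> \<Sigma>" using assms(2) by (auto simp: clique_set_def)
    from letter_divides_clique_trace[OF assms(2) a] dx have "T [a] \<preceq> x"
      by (rule traces.divides_trans) (simp add: \<open>a \<in> \<Sigma>\<close>)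
    with \<open>a \<in> \<Sigma>\<close> show "a \<in> first_letters x" by (simp add: first_letters_def)
  qed
next
  assume "d \<subseteq> first_letters x"
  with finite_clique_set[OF assms(2)] show "clique_trace d \<preceq> x"
    using assms(2)
  proof (induction d rule: finite_induct)
    case empty
    show ?case using assms(1) by (simp add: traces.one_divides)
  next
    case (insert a d)
    have a: "a \<in> \<Sigma>" "T [a] \<preceq> x" using insert.prems(1) by (auto simp: first_letters_def)
    have d: "clique_set d" using insert.prems(2) by (rule clique_set_subset) auto
    have "clique_trace d \<odot> T [a] \<preceq> x"
      using mult_letter_divides(1)[of "clique_trace d" x a] insert d a assms(1)
      by (simp add: letters_clique_trace)
    then show ?case
      using clique_trace_Un[of d "{a}"] insert.hyps insert.prems(2) a(1)
      by (simp add: clique_trace_singleton)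
  qed
qed

lemma first_letters_subset_letters: "x \<in> carrier M \<Longrightarrow> first_letters x \<subseteq> letters x"
proof
  fix a assume "x \<in> carrier M" "a \<in> first_letters x"
  then show "a \<in> letters x"
    using letter_count_mono[of "T [a]" x a] by (simp add: first_letters_def letters_def)
qed

lemma first_letters_clique_trace:
  assumes "clique_set d"
  shows "first_letters (clique_trace d) = d"
  using clique_trace_divides_iff[of "clique_trace d" d] assms
    first_letters_subset_letters[of "clique_trace d"]
  by (simp add: letters_clique_trace subset_antisym)

lemma first_letters_eq_empty_iff:
  assumes "x \<in> carrier M"
  shows "first_letters x = {} \<longleftrightarrow> x = \<epsilon>"
proof
  assume none: "first_letters x = {}"
  show "x = \<epsilon>"
  proof (rule ccontr)
    assume "x \<noteq> \<epsilon>"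
    then obtain a where "a \<in> \<Sigma>" "\<epsilon> \<odot> T [a] \<preceq> x"
      using divides_neq_letter[of \<epsilon> x] traces.one_divides[OF assms] by auto
    then show False using none by (auto simp: first_letters_def)
  qed
qed (use first_letters_clique_trace[OF clique_set_empty] in simp)

lemma trace_cliques_eq: "trace_cliques \<Sigma> I = clique_trace ` {d. clique_set d}"
proof (intro equalityI subsetI)
  fix c assume "c \<in> trace_cliques \<Sigma> I"
  then obtain xs where xs: "c = T xs" "set xs \<subseteq> \<Sigma>"
    and indep: "\<And>i j. i < length xs \<Longrightarrow> j < length xs \<Longrightarrow> i \<noteq> j \<Longrightarrow> (xs ! i, xs ! j) \<in> I"
    by (auto simp: trace_cliques_def)
  have "distinct xs" unfolding distinct_conv_nth using indep indep_neq by blast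
  moreover have "clique_set (set xs)"
    using xs(2) indep by (auto simp: clique_set_def pairwise_def in_set_conv_nth) metis
  ultimately show "c \<in> clique_trace ` {d. clique_set d}" using clique_trace_set xs(1) by auto
next
  fix c assume "c \<in> clique_trace ` {d. clique_set d}"
  then obtain d where d: "clique_set d" "c = clique_trace d" by auto
  obtain xs where xs: "set xs = d" "distinct xs" "set xs \<subseteq> \<Sigma>" "clique_trace d = T xs"
    using clique_wordE[OF d(1)] .
  have "(xs ! i, xs ! j) \<in> I" if "i < length xs" "j < length xs" "i \<noteq> j" for i j
    using that d(1) xs(1,2) nth_mem nth_eq_iff_index_eq
    by (fastforce simp: clique_set_def pairwise_def)
  then show "c \<in> trace_cliques \<Sigma> I" using xs(3,4) d(2) by (auto simp: trace_cliques_def)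
qed

section \<open>The clique polynomial and the Moebius transform\<close>

lemma valuation_pos: "valuation \<Sigma> I f \<Longrightarrow> u \<in> carrier M \<Longrightarrow> f u > 0"
  by (simp add: valuation_def)

lemma valuation_mult:
  "valuation \<Sigma> I f \<Longrightarrow> u \<in> carrier M \<Longrightarrow> v \<in> carrier M \<Longrightarrow> f (u \<odot> v) = f u * f v"
  by (simp add: valuation_def)

lemma valuation_one: "valuation \<Sigma> I f \<Longrightarrow> f \<epsilon> = 1"
  using valuation_mult[of f \<epsilon> \<epsilon>] valuation_pos[of f \<epsilon>] by simp

definition clique_poly :: "('a list set \<Rightarrow> real) \<Rightarrow> 'a set \<Rightarrow> real" where
  "clique_poly f N = (\<Sum>d | clique_set d \<and> d \<subseteq> N. (- 1) ^ card d * f (clique_trace d))"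

lemma moebius_transform_eq_sum:
  assumes c: "clique_set c"
  shows "moebius_transform \<Sigma> I f (clique_trace c) =
    (\<Sum>d | clique_set d \<and> c \<subseteq> d. (- 1) ^ (card d - card c) * f (clique_trace d))"
proof -
  have "clique_trace c \<preceq> clique_trace d \<longleftrightarrow> c \<subseteq> d" if "clique_set d" for d
    using that c by (simp add: clique_trace_divides_iff first_letters_clique_trace)
  then have "{c'. c' \<in> trace_cliques \<Sigma> I \<and> clique_trace c \<preceq> c'} =
      clique_trace ` {d. clique_set d \<and> c \<subseteq> d}"
    by (auto simp: trace_cliques_eq)
  moreover have "inj_on clique_trace {d. clique_set d \<and> c \<subseteq> d}"
    using inj_on_clique_trace by (rule inj_on_subset) auto
  ultimately show ?thesis
    unfolding moebius_transform_def
    by (simp add: sum.reindex trace_length_clique_trace c)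
qed

lemma moebius_transform_eq_clique_poly:
  assumes f: "valuation \<Sigma> I f" and c: "clique_set c"
  shows "moebius_transform \<Sigma> I f (clique_trace c) =
    f (clique_trace c) * clique_poly f (commuting_letters c)"
proof -
  have disj: "c \<inter> d = {}" if "d \<subseteq> commuting_letters c" for d
    using that indep_neq by (fastforce simp: commuting_letters_def)
  have Diff: "clique_set (d - c)" "d - c \<subseteq> commuting_letters c" if "clique_set d" "c \<subseteq> d" for d
    using clique_set_Un_iff[OF c, of "d - c"] that by (simp_all add: Un_absorb1)
  have "moebius_transform \<Sigma> I f (clique_trace c) =
      (\<Sum>d | clique_set d \<and> d \<subseteq> commuting_letters c.
        f (clique_trace c) * ((- 1) ^ card d * f (clique_trace d)))"
    unfolding moebius_transform_eq_sum[OF c]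
  proof (rule sum.reindex_bij_witness[where i = "\<lambda>d. c \<union> d" and j = "\<lambda>d. d - c"])
    fix d assume d: "d \<in> {d. clique_set d \<and> c \<subseteq> d}"
    then have "clique_trace d = clique_trace c \<odot> clique_trace (d - c)"
      using clique_trace_Un[of c "d - c"] by (simp add: Un_absorb1)
    moreover have "card (d - c) = card d - card c"
      using d finite_clique_set[OF c] by (simp add: card_Diff_subset)
    ultimately show "f (clique_trace c) * ((- 1) ^ card (d - c) * f (clique_trace (d - c))) =
        (- 1) ^ (card d - card c) * f (clique_trace d)"
      using valuation_mult[OF f] Diff d c by simp
  qed (use disj Diff clique_set_Un_iff[OF c] in auto)
  then show ?thesis by (simp add: clique_poly_def sum_distrib_left)
qed

lemma moebius_transform_one:
  assumes "valuation \<Sigma> I f"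
  shows "moebius_transform \<Sigma> I f \<epsilon> = clique_poly f \<Sigma>"
  using moebius_transform_eq_clique_poly[OF assms clique_set_empty] valuation_one[OF assms]
  by (simp add: commuting_letters_def)

lemma clique_poly_eq_sum_moebius_transform:
  "clique_poly f N = (\<Sum>c | clique_set c \<and> c \<inter> N = {}. moebius_transform \<Sigma> I f (clique_trace c))"
proof -
  let ?term = "\<lambda>c d. (- 1) ^ (card d - card c) * f (clique_trace d)"
  have "(\<Sum>c | clique_set c \<and> c \<inter> N = {}. moebius_transform \<Sigma> I f (clique_trace c)) =
      (\<Sum>c | clique_set c \<and> c \<inter> N = {}. \<Sum>d | d \<in> {d. clique_set d} \<and> c \<subseteq> d. ?term c d)"
    by (simp add: moebius_transform_eq_sum)
  also have "\<dots> = (\<Sum>d | clique_set d. \<Sum>c | c \<in> {c. clique_set c \<and> c \<inter> N = {}} \<and> c \<subseteq> d. ?term c d)"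
    using finite_clique_sets[of "\<lambda>_. True"] finite_clique_sets by (intro sum.swap_restrict) simp_all
  also have "\<dots> = (\<Sum>d | clique_set d. if d \<subseteq> N then (- 1) ^ card d * f (clique_trace d) else 0)"
  proof (rule sum.cong[OF HOL.refl])
    fix d assume "d \<in> {d. clique_set d}"
    then have d: "clique_set d" "finite d" using finite_clique_set by simp_all
    have sign: "(- 1 :: real) ^ (card d - card c) = (- 1) ^ card d * (- 1) ^ card c"
      if "c \<subseteq> d - N" for c
    proof -
      have "card c \<le> card d" using that d(2) by (intro card_mono) auto
      then show ?thesis by (simp add: neg_one_power_add_eq_neg_one_power_diff flip: power_add)
    qed
    have "{c. c \<in> {c. clique_set c \<and> c \<inter> N = {}} \<and> c \<subseteq> d} = Pow (d - N)"
      using d clique_set_subset by auto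
    then have "(\<Sum>c | c \<in> {c. clique_set c \<and> c \<inter> N = {}} \<and> c \<subseteq> d. ?term c d) =
        (\<Sum>c\<in>Pow (d - N). (- 1) ^ card d * f (clique_trace d) * (- 1) ^ card c)"
      by (intro sum.cong) (auto simp: sign)
    also have "\<dots> = (- 1) ^ card d * f (clique_trace d) * (\<Sum>c\<in>Pow (d - N). (- 1) ^ card c)"
      by (simp only: sum_distrib_left)
    also have "\<dots> = (if d \<subseteq> N then (- 1) ^ card d * f (clique_trace d) else 0)"
      using d(2) by (simp add: sum_Pow_neg_one_power_card)
    finally show "(\<Sum>c | c \<in> {c. clique_set c \<and> c \<inter> N = {}} \<and> c \<subseteq> d. ?term c d) =
      (if d \<subseteq> N then (- 1) ^ card d * f (clique_trace d) else 0)" .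
  qed
  also have "\<dots> = clique_poly f N"
    unfolding clique_poly_def using finite_clique_sets[of "\<lambda>_. True"]
    by (subst sum.inter_filter[symmetric]) auto
  finally show ?thesis by simp
qed

lemma moebius_valuation_valuation: "moebius_valuation \<Sigma> I f \<Longrightarrow> valuation \<Sigma> I f"
  by (simp add: moebius_valuation_def)

lemma clique_poly_nonneg:
  assumes f: "moebius_valuation \<Sigma> I f"
  shows "clique_poly f N \<ge> 0"
  unfolding clique_poly_eq_sum_moebius_transform
proof (rule sum_nonneg)
  fix c assume "c \<in> {c. clique_set c \<and> c \<inter> N = {}}"
  then show "moebius_transform \<Sigma> I f (clique_trace c) \<ge> 0"
    using f unfolding moebius_valuation_def trace_cliques_eq
    by (cases "clique_trace c = \<epsilon>") (auto intro: less_imp_le)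
qed

section \<open>The weights of the truncations\<close>

definition trunc_weight :: "('a list set \<Rightarrow> real) \<Rightarrow> ('a \<Rightarrow> nat) \<Rightarrow> 'a list set \<Rightarrow> real" where
  "trunc_weight f K u = f u * clique_poly f (free_letters K u)"

lemma clique_trace_mult_bounded_traces_iff:
  assumes "clique_set d" "u \<in> carrier M"
  shows "clique_trace d \<odot> u \<in> bounded_traces K \<longleftrightarrow> u \<in> bounded_traces K \<and> d \<subseteq> free_letters K u"
proof -
  have "(if a \<in> d then 1 else 0) + letter_count u a \<le> K a \<longleftrightarrow>
      letter_count u a \<le> K a \<and> (a \<in> d \<longrightarrow> letter_count u a < K a)" for a
    by auto
  then show ?thesis
    using assms
    by (auto simp: bounded_traces_def free_letters_def letter_count_clique_trace clique_set_def)
qed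

lemma sum_clique_divisors_neg_one_power_card:
  assumes "x \<in> carrier M"
  shows "(\<Sum>d | clique_set d \<and> clique_trace d \<preceq> x. (- 1) ^ card d) =
    (if x = \<epsilon> then 1 else 0 :: real)"
proof -
  have "clique_set d" if "d \<subseteq> first_letters x" for d
    using clique_set_subset[OF clique_set_first_letters[OF assms] that] .
  then have "{d. clique_set d \<and> clique_trace d \<preceq> x} = Pow (first_letters x)"
    using clique_trace_divides_iff[OF assms] by auto
  then show ?thesis
    using sum_Pow_neg_one_power_card[OF finite_clique_set[OF clique_set_first_letters[OF assms]]]
    by (simp add: first_letters_eq_empty_iff assms)
qed

text \<open>Expanding the clique polynomials, \<open>f(x)\<close> occurs once with sign \<open>(-1)\<^sup>|\<^sup>d\<^sup>|\<close> for every
  clique \<open>d\<close> dividing \<open>x\<close>, so that only the empty trace survives.\<close>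

lemma sum_trunc_weight:
  assumes f: "valuation \<Sigma> I f"
  shows "(\<Sum>u\<in>bounded_traces K. trunc_weight f K u) = 1"
proof -
  let ?B = "bounded_traces K"
  have "(\<Sum>u\<in>?B. trunc_weight f K u) =
      (\<Sum>u\<in>?B. \<Sum>d | d \<in> {d. clique_set d} \<and> d \<subseteq> free_letters K u.
        (- 1) ^ card d * f (clique_trace d \<odot> u))"
    by (intro sum.cong)
      (auto simp: trunc_weight_def clique_poly_def sum_distrib_left valuation_mult[OF f]
        bounded_traces_carrier mult_ac intro!: sum.cong)
  also have "\<dots> = (\<Sum>d | clique_set d. \<Sum>u | u \<in> ?B \<and> d \<subseteq> free_letters K u.
      (- 1) ^ card d * f (clique_trace d \<odot> u))"
    using finite_clique_sets[of "\<lambda>_. True"] finite_bounded_traces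
    by (intro sum.swap_restrict) simp_all
  also have "\<dots> = (\<Sum>d | clique_set d. \<Sum>x | x \<in> ?B \<and> clique_trace d \<preceq> x. (- 1) ^ card d * f x)"
  proof (rule sum.cong[OF HOL.refl])
    fix d assume "d \<in> {d. clique_set d}"
    then have "{u. u \<in> ?B \<and> d \<subseteq> free_letters K u} = {u \<in> carrier M. clique_trace d \<odot> u \<in> ?B}"
      using clique_trace_mult_bounded_traces_iff bounded_traces_carrier by auto
    then show "(\<Sum>u | u \<in> ?B \<and> d \<subseteq> free_letters K u. (- 1) ^ card d * f (clique_trace d \<odot> u)) =
        (\<Sum>x | x \<in> ?B \<and> clique_trace d \<preceq> x. (- 1) ^ card d * f x)"
      using sum.reindex_bij_betw[OF traces.bij_betw_mult_left, of "clique_trace d"]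
        \<open>d \<in> {d. clique_set d}\<close> by simp
  qed
  also have "\<dots> = (\<Sum>x\<in>?B. \<Sum>d | d \<in> {d. clique_set d} \<and> clique_trace d \<preceq> x. (- 1) ^ card d * f x)"
    using finite_clique_sets[of "\<lambda>_. True"] finite_bounded_traces
    by (intro sum.swap_restrict) simp_all
  also have "\<dots> = (\<Sum>x\<in>?B. if x = \<epsilon> then f x else 0)"
    by (intro sum.cong)
      (auto simp: sum_clique_divisors_neg_one_power_card bounded_traces_carrier
        simp flip: sum_distrib_right)
  also have "\<dots> = 1"
    using one_bounded_traces finite_bounded_traces valuation_one[OF f] by simp
  finally show ?thesis .
qed

lemma sum_trunc_weight_multiples:
  assumes f: "valuation \<Sigma> I f" and u: "u \<in> bounded_traces K"
  shows "(\<Sum>x | x \<in> bounded_traces K \<and> u \<preceq> x. trunc_weight f K x) = f u"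
proof -
  let ?K = "\<lambda>a. K a - letter_count u a"
  have u_carrier: "u \<in> carrier M" and count_u: "\<And>a. letter_count u a \<le> K a"
    using u by (simp_all add: bounded_traces_def)
  have count_le_iff: "letter_count u a + n \<le> K a \<longleftrightarrow> n \<le> ?K a"
    and count_less_iff: "letter_count u a + n < K a \<longleftrightarrow> n < ?K a" for a n
    using count_u[of a] by auto
  have quotients: "{w \<in> carrier M. u \<odot> w \<in> bounded_traces K} = bounded_traces ?K"
    using u_carrier by (auto simp: bounded_traces_def count_le_iff)
  have "free_letters K (u \<odot> w) = free_letters ?K w" if "w \<in> carrier M" for w
    using u_carrier that by (simp add: free_letters_def count_less_iff)
  then have weight: "trunc_weight f K (u \<odot> w) = f u * trunc_weight f ?K w"
    if "w \<in> bounded_traces ?K" for w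
    using that u_carrier by (simp add: trunc_weight_def valuation_mult[OF f] bounded_traces_carrier)
  have "(\<Sum>x | x \<in> bounded_traces K \<and> u \<preceq> x. trunc_weight f K x) =
      (\<Sum>w\<in>bounded_traces ?K. trunc_weight f K (u \<odot> w))"
    using sum.reindex_bij_betw[OF traces.bij_betw_mult_left[OF u_carrier, of "bounded_traces K"],
        of "trunc_weight f K"] by (simp add: quotients)
  also have "\<dots> = f u"
    using sum_trunc_weight[OF f, of ?K] by (simp add: weight flip: sum_distrib_left)
  finally show ?thesis .
qed

section \<open>Families of divisibility events\<close>

definition multiples :: "'a list set \<Rightarrow> 'a list set set" where
  "multiples u = {x \<in> carrier M. u \<preceq> x}"

text \<open>\<open>E u\<close> is the event that \<open>u\<close> divides a random finite or infinite trace.\<close>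

definition divisor_events :: "('a list set \<Rightarrow> 'b set) \<Rightarrow> bool" where
  "divisor_events E \<longleftrightarrow>
    (\<forall>u\<in>carrier M. \<forall>v\<in>carrier M. E u \<inter> E v = (\<Union>x\<in>multiples u \<inter> multiples v. E x))"

lemma divisor_eventsI:
  assumes mono: "\<And>u v. u \<in> carrier M \<Longrightarrow> v \<in> carrier M \<Longrightarrow> u \<preceq> v \<Longrightarrow> E v \<subseteq> E u"
    and directed: "\<And>u v \<omega>. u \<in> carrier M \<Longrightarrow> v \<in> carrier M \<Longrightarrow> \<omega> \<in> E u \<Longrightarrow> \<omega> \<in> E v \<Longrightarrow>
      \<exists>x\<in>multiples u \<inter> multiples v. \<omega> \<in> E x"
  shows "divisor_events E"
  unfolding divisor_events_def
proof (intro ballI)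
  fix u v assume uv: "u \<in> carrier M" "v \<in> carrier M"
  then have "E x \<subseteq> E u \<inter> E v" if "x \<in> multiples u \<inter> multiples v" for x
    using that mono by (simp add: multiples_def)
  then show "E u \<inter> E v = (\<Union>x\<in>multiples u \<inter> multiples v. E x)" using directed[OF uv] by blast
qed

lemma divisor_events_common_multiple:
  assumes "divisor_events E" "u \<in> carrier M" "v \<in> carrier M" "\<omega> \<in> E u" "\<omega> \<in> E v"
  obtains x where "x \<in> carrier M" "u \<preceq> x" "v \<preceq> x" "\<omega> \<in> E x"
proof -
  have "\<omega> \<in> (\<Union>x\<in>multiples u \<inter> multiples v. E x)"
    using assms by (simp flip: divisor_events_def[THEN iffD1, rule_format])
  then show thesis using that by (auto simp: multiples_def)
qed

lemma divisor_events_mono: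
  assumes "divisor_events E" "u \<in> carrier M" "v \<in> carrier M" "u \<preceq> v"
  shows "E v \<subseteq> E u"
proof -
  have "E v \<subseteq> (\<Union>x\<in>multiples u \<inter> multiples v. E x)" using assms(3,4) by (auto simp: multiples_def)
  also have "\<dots> = E u \<inter> E v" using assms(1-3) by (simp add: divisor_events_def)
  finally show ?thesis by simp
qed

lemma divisor_events_Int:
  assumes "divisor_events E" "u \<in> carrier M" "v \<in> carrier M"
  shows "E u \<inter> E v \<in> insert {} (E ` carrier M)"
proof (cases "E u \<inter> E v = {}")
  case False
  then obtain \<omega> where "\<omega> \<in> E u" "\<omega> \<in> E v" by blast
  then obtain x where "x \<in> carrier M" "u \<preceq> x" "v \<preceq> x"
    using divisor_events_common_multiple[OF assms] by metis
  then obtain w where "letterwise_lcm w u v"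
    using letterwise_lcm_exists[OF assms(2,3)] by blast
  then have w: "w \<in> carrier M" and lcm: "w lcmof\<^bsub>M\<^esub> u v" by (simp_all add: letterwise_lcm_def)
  have "E x \<subseteq> E w" if "x \<in> multiples u \<inter> multiples v" for x
    using that lcm divisor_events_mono[OF assms(1) w] by (simp add: multiples_def islcm_def)
  moreover have "w \<in> multiples u \<inter> multiples v" using w lcm by (simp add: multiples_def islcm_def)
  ultimately have "(\<Union>x\<in>multiples u \<inter> multiples v. E x) = E w" by blast
  then have "E u \<inter> E v = E w" using assms by (simp add: divisor_events_def)
  then show ?thesis using w by simp
qed simp

lemma divisor_events_multiples: "divisor_events multiples"
proof (rule divisor_eventsI)
  show "multiples v \<subseteq> multiples u" if "u \<in> carrier M" "u \<preceq> v" for u v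
    using traces.divides_trans[OF that(2) _ that(1)] by (auto simp: multiples_def)
  show "\<exists>x\<in>multiples u \<inter> multiples v. y \<in> multiples x"
    if "y \<in> multiples u" "y \<in> multiples v" for u v y
    using that by (intro bexI[of _ y]) (simp_all add: multiples_def)
qed

lemma divisor_events_finite_common_multiple:
  assumes E: "divisor_events E" and "finite A" "A \<subseteq> carrier M" "v \<in> carrier M" "\<omega> \<in> E v"
    and "\<And>u. u \<in> A \<Longrightarrow> \<omega> \<in> E u"
  shows "\<exists>x\<in>carrier M. v \<preceq> x \<and> (\<forall>u\<in>A. u \<preceq> x) \<and> \<omega> \<in> E x"
  using assms(2,3,6)
proof (induction A rule: finite_induct)
  case empty
  then show ?case using assms(4,5) by (intro bexI[of _ v]) simp_all
next
  case (insert u A)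
  then obtain x where x: "x \<in> carrier M" "v \<preceq> x" "\<forall>u\<in>A. u \<preceq> x" "\<omega> \<in> E x" by blast
  obtain y where y: "y \<in> carrier M" "u \<preceq> y" "x \<preceq> y" "\<omega> \<in> E y"
    using divisor_events_common_multiple[OF E _ x(1) _ x(4), of u] insert.prems by blast
  have "w \<preceq> y" if "w \<in> carrier M" "w \<preceq> x" for w
    using traces.divides_trans[OF that(2) y(3) that(1)] .
  then show ?case using x y assms(4) insert.prems(1) by (intro bexI[of _ y]) auto
qed

lemma divisor_events_Inter_letters:
  assumes E: "divisor_events E" and v: "v \<in> carrier M" and d: "d \<subseteq> \<Sigma>"
  shows "E v \<inter> (\<Inter>a\<in>d. E (v \<odot> T [a])) = (if clique_set d then E (v \<odot> clique_trace d) else {})"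
proof -
  have clique: "clique_set d \<and> \<omega> \<in> E (v \<odot> clique_trace d)"
    if v\<omega>: "\<omega> \<in> E v" and va\<omega>: "\<And>a. a \<in> d \<Longrightarrow> \<omega> \<in> E (v \<odot> T [a])" for \<omega>
  proof -
    let ?A = "(\<lambda>a. v \<odot> T [a]) ` d"
    have "finite ?A" using d finite_letters finite_subset by blast
    moreover have "?A \<subseteq> carrier M" "\<And>u. u \<in> ?A \<Longrightarrow> \<omega> \<in> E u" using va\<omega> v d by auto
    ultimately obtain x where x: "x \<in> carrier M" "v \<preceq> x" "\<forall>u\<in>?A. u \<preceq> x" "\<omega> \<in> E x"
      using divisor_events_finite_common_multiple[where v = v, OF E _ _ v v\<omega>] by metis
    obtain y where y: "y \<in> carrier M" "x = v \<odot> y" using x(2) by (auto elim: dividesE)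
    have sub: "d \<subseteq> first_letters y"
    proof
      fix a assume "a \<in> d"
      then have "a \<in> \<Sigma>" "v \<odot> T [a] \<preceq> v \<odot> y" using d x(3) y(2) by auto
      then show "a \<in> first_letters y" using v y(1) by (simp add: first_letters_def)
    qed
    then have "clique_set d" by (rule clique_set_subset[OF clique_set_first_letters[OF y(1)]])
    moreover have "clique_trace d \<preceq> y"
      using sub y(1) \<open>clique_set d\<close> by (simp add: clique_trace_divides_iff)
    ultimately show ?thesis
      using divisor_events_mono[OF E _ x(1), of "v \<odot> clique_trace d"] x(4) y v by auto
  qed
  moreover have "E (v \<odot> clique_trace d) \<subseteq> E v \<inter> (\<Inter>a\<in>d. E (v \<odot> T [a]))" if clq: "clique_set d"
  proof -
    have "E (v \<odot> clique_trace d) \<subseteq> E (v \<odot> T [a])" if "a \<in> d" for a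
      using that d v clq letter_divides_clique_trace[OF clq that]
      by (intro divisor_events_mono[OF E]) auto
    moreover have "E (v \<odot> clique_trace d) \<subseteq> E v"
      using v clq by (intro divisor_events_mono[OF E]) (simp_all add: traces.divides_mult)
    ultimately show ?thesis by blast
  qed
  ultimately show ?thesis by (simp split: if_split) blast
qed

lemma measure_divisor_events_Diff:
  assumes P: "finite_measure P" and E: "divisor_events E" "\<And>u. u \<in> carrier M \<Longrightarrow> E u \<in> sets P"
    and f: "valuation \<Sigma> I f" and v: "v \<in> carrier M" and N: "N \<subseteq> \<Sigma>"
    and f_eq: "\<And>d. clique_set d \<Longrightarrow> d \<subseteq> N \<Longrightarrow>
      measure P (E (v \<odot> clique_trace d)) = f (v \<odot> clique_trace d)"
  shows "measure P (E v - (\<Union>a\<in>N. E (v \<odot> T [a]))) = f v * clique_poly f N"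
proof -
  interpret finite_measure P by fact
  have "finite N" using N finite_letters by (rule finite_subset)
  have Eva: "E (v \<odot> T [a]) \<in> sets P" "E (v \<odot> T [a]) \<subseteq> E v" if "a \<in> N" for a
  proof -
    have "a \<in> \<Sigma>" using N that by blast
    then show "E (v \<odot> T [a]) \<in> sets P" "E (v \<odot> T [a]) \<subseteq> E v"
      using v by (simp_all add: E(2) divisor_events_mono[OF E(1)] traces.divides_mult)
  qed
  have signed: "(- 1) ^ card d * measure P (E v \<inter> (\<Inter>a\<in>d. E (v \<odot> T [a]))) =
      (if clique_set d then f v * ((- 1) ^ card d * f (clique_trace d)) else 0)" if "d \<subseteq> N" for d
    using that divisor_events_Inter_letters[OF E(1) v, of d] N f_eq[of d] valuation_mult[OF f v]
    by auto
  have "measure P (E v - (\<Union>a\<in>N. E (v \<odot> T [a]))) =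
      (\<Sum>d\<in>Pow N. (- 1) ^ card d * measure P (E v \<inter> (\<Inter>a\<in>d. E (v \<odot> T [a]))))"
    using \<open>finite N\<close> E(2)[OF v] Eva by (rule measure_Diff_UN_eq_sum)
  also have "\<dots> = (\<Sum>d | clique_set d \<and> d \<subseteq> N. f v * ((- 1) ^ card d * f (clique_trace d)))"
    using \<open>finite N\<close> by (intro sum.mono_neutral_cong_right) (auto simp: signed)
  also have "\<dots> = f v * clique_poly f N" by (simp add: clique_poly_def sum_distrib_left)
  finally show ?thesis .
qed

section \<open>The boundary and its cylinders\<close>

abbreviation trace_cylinder :: "'a list set \<Rightarrow> (nat \<Rightarrow> 'a list set) set set" ("\<up>") where
  "\<up> \<equiv> cylinder \<Sigma> I"

definition seq_class :: "(nat \<Rightarrow> 'a list set) \<Rightarrow> (nat \<Rightarrow> 'a list set) set" where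
  "seq_class s = trace_seq_rel \<Sigma> I `` {s}"

lemma trace_seqs_carrier: "s \<in> trace_seqs \<Sigma> I \<Longrightarrow> s k \<in> carrier M"
  by (auto simp: trace_seqs_def)

lemma trace_seqs_mono: "s \<in> trace_seqs \<Sigma> I \<Longrightarrow> k \<le> l \<Longrightarrow> s k \<preceq> s l"
  by (auto simp: trace_seqs_def monotone_def)

lemma const_trace_seqs: "u \<in> carrier M \<Longrightarrow> (\<lambda>_. u) \<in> trace_seqs \<Sigma> I"
  by (auto simp: trace_seqs_def monotone_def)

lemma trace_seq_le_refl: "s \<in> trace_seqs \<Sigma> I \<Longrightarrow> trace_seq_le \<Sigma> I s s"
  unfolding trace_seq_le_def using trace_seqs_carrier by blast

lemma trace_seq_le_trans:
  assumes "s \<in> trace_seqs \<Sigma> I" "trace_seq_le \<Sigma> I s t" "trace_seq_le \<Sigma> I t r"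
  shows "trace_seq_le \<Sigma> I s r"
  using assms traces.divides_trans trace_seqs_carrier unfolding trace_seq_le_def by meson

lemma equiv_trace_seq_rel: "equiv (trace_seqs \<Sigma> I) (trace_seq_rel \<Sigma> I)"
proof (rule equivI)
  show "trans (trace_seq_rel \<Sigma> I)"
    using trace_seq_le_trans unfolding trans_def trace_seq_rel_def by blast
qed (auto simp: trace_seq_rel_def refl_on_def sym_def trace_seq_le_refl)

lemma seq_class_eq_iff:
  assumes "s \<in> trace_seqs \<Sigma> I" "t \<in> trace_seqs \<Sigma> I"
  shows "seq_class s = seq_class t \<longleftrightarrow> trace_seq_le \<Sigma> I s t \<and> trace_seq_le \<Sigma> I t s"
  unfolding seq_class_def using eq_equiv_class_iff[OF equiv_trace_seq_rel assms] assms
  by (simp add: trace_seq_rel_def)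

lemma gen_trace_le_seq_class_iff:
  assumes s: "s \<in> trace_seqs \<Sigma> I" and t: "t \<in> trace_seqs \<Sigma> I"
  shows "gen_trace_le \<Sigma> I (seq_class s) (seq_class t) \<longleftrightarrow> trace_seq_le \<Sigma> I s t"
proof
  assume "gen_trace_le \<Sigma> I (seq_class s) (seq_class t)"
  then obtain s' t' where "s' \<in> trace_seqs \<Sigma> I" "t' \<in> trace_seqs \<Sigma> I"
    and le: "trace_seq_le \<Sigma> I s s'" "trace_seq_le \<Sigma> I s' t'" "trace_seq_le \<Sigma> I t' t"
    by (auto simp: gen_trace_le_def seq_class_def trace_seq_rel_def)
  have "trace_seq_le \<Sigma> I s t'" using s le(1,2) by (rule trace_seq_le_trans)
  with s show "trace_seq_le \<Sigma> I s t" using le(3) by (rule trace_seq_le_trans)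
next
  have "s \<in> seq_class s" "t \<in> seq_class t"
    using s t trace_seq_le_refl by (simp_all add: seq_class_def trace_seq_rel_def)
  then show "gen_trace_le \<Sigma> I (seq_class s) (seq_class t)" if "trace_seq_le \<Sigma> I s t"
    using that unfolding gen_trace_le_def by blast
qed

lemma boundaryE:
  assumes "\<xi> \<in> boundary \<Sigma> I" obtains s where "s \<in> trace_seqs \<Sigma> I" "\<xi> = seq_class s"
  using assms by (auto simp: boundary_def gen_traces_def seq_class_def quotient_def)

text \<open>A sequence of bounded length is constant from the first term of maximal length on.\<close>

lemma seq_class_in_boundary_iff:
  assumes s: "s \<in> trace_seqs \<Sigma> I"
  shows "seq_class s \<in> boundary \<Sigma> I \<longleftrightarrow> (\<forall>n. \<exists>k. n < trace_length (s k))"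
proof -
  have "seq_class s \<in> gen_traces \<Sigma> I" using s by (simp add: gen_traces_def seq_class_def quotientI)
  moreover have "seq_class s = trace_embed \<Sigma> I x \<longleftrightarrow> (\<forall>k. s k \<preceq> x) \<and> (\<exists>k. x \<preceq> s k)"
    if "x \<in> carrier M" for x
    using seq_class_eq_iff[OF s const_trace_seqs[OF that]]
    by (simp add: trace_embed_def seq_class_def trace_seq_le_def)
  ultimately have "seq_class s \<in> boundary \<Sigma> I \<longleftrightarrow>
      \<not> (\<exists>x\<in>carrier M. (\<forall>k. s k \<preceq> x) \<and> (\<exists>k. x \<preceq> s k))"
    by (simp add: boundary_def image_iff cong: bex_cong)
  also have "(\<exists>x\<in>carrier M. (\<forall>k. s k \<preceq> x) \<and> (\<exists>k. x \<preceq> s k)) \<longleftrightarrow>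
      (\<exists>n. \<forall>k. trace_length (s k) \<le> n)"
  proof
    show "\<exists>n. \<forall>k. trace_length (s k) \<le> n"
      if "\<exists>x\<in>carrier M. (\<forall>k. s k \<preceq> x) \<and> (\<exists>k. x \<preceq> s k)"
      using that trace_length_mono trace_seqs_carrier[OF s] by blast
  next
    assume "\<exists>n. \<forall>k. trace_length (s k) \<le> n"
    then obtain k where longest: "\<And>l. trace_length (s l) \<le> trace_length (s k)"
      using ex_has_greatest_nat[of "\<lambda>_. True" _ "\<lambda>k. trace_length (s k)"] by (metis le_imp_less_Suc)
    have "s l \<preceq> s k" for l
    proof -
      have "s k = s (max k l)"
        using divides_trace_length_eq[of "s k" "s (max k l)"] trace_seqs_carrier[OF s] longest
          trace_seqs_mono[OF s, of k "max k l"] by simp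
      then show ?thesis using trace_seqs_mono[OF s, of l "max k l"] by simp
    qed
    then show "\<exists>x\<in>carrier M. (\<forall>k. s k \<preceq> x) \<and> (\<exists>k. x \<preceq> s k)"
      using trace_seqs_carrier[OF s] by blast
  qed
  finally show ?thesis by (simp add: not_le)
qed

lemma seq_class_in_cylinder_iff:
  assumes "s \<in> trace_seqs \<Sigma> I" "u \<in> carrier M"
  shows "seq_class s \<in> \<up> u \<longleftrightarrow> seq_class s \<in> boundary \<Sigma> I \<and> (\<exists>k. u \<preceq> s k)"
  using gen_trace_le_seq_class_iff[OF const_trace_seqs[OF assms(2)] assms(1)]
  by (simp add: cylinder_def trace_embed_def seq_class_def trace_seq_le_def)

lemma cylinder_subset_boundary: "\<up> u \<subseteq> boundary \<Sigma> I"
  by (auto simp: cylinder_def)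

lemma cylinder_one: "\<up> \<epsilon> = boundary \<Sigma> I"
proof
  show "boundary \<Sigma> I \<subseteq> \<up> \<epsilon>"
  proof
    fix \<xi> assume \<xi>: "\<xi> \<in> boundary \<Sigma> I"
    then obtain s where s: "s \<in> trace_seqs \<Sigma> I" "\<xi> = seq_class s" by (rule boundaryE)
    then show "\<xi> \<in> \<up> \<epsilon>"
      using \<xi> traces.one_divides[OF trace_seqs_carrier[OF s(1)]]
      by (simp add: seq_class_in_cylinder_iff)
  qed
qed (rule cylinder_subset_boundary)

lemma cylinder_mono:
  assumes "u \<in> carrier M" "v \<in> carrier M" "u \<preceq> v"
  shows "\<up> v \<subseteq> \<up> u"
proof
  fix \<xi> assume \<xi>: "\<xi> \<in> \<up> v"
  then obtain s where s: "s \<in> trace_seqs \<Sigma> I" "\<xi> = seq_class s"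
    using cylinder_subset_boundary boundaryE by blast
  then obtain k where "\<xi> \<in> boundary \<Sigma> I" "v \<preceq> s k"
    using \<xi> assms(2) by (auto simp: seq_class_in_cylinder_iff)
  moreover from assms(3) \<open>v \<preceq> s k\<close> assms(1) have "u \<preceq> s k" by (rule traces.divides_trans)
  ultimately show "\<xi> \<in> \<up> u" using s assms(1) by (auto simp: seq_class_in_cylinder_iff)
qed

lemma divisor_events_cylinder: "divisor_events \<up>"
proof (rule divisor_eventsI[OF cylinder_mono])
  fix u v \<xi> assume u: "u \<in> carrier M" "\<xi> \<in> \<up> u" and v: "v \<in> carrier M" "\<xi> \<in> \<up> v"
  then have "\<xi> \<in> boundary \<Sigma> I" using cylinder_subset_boundary by blast
  then obtain s where s: "s \<in> trace_seqs \<Sigma> I" "\<xi> = seq_class s" by (rule boundaryE)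
  obtain k l where "u \<preceq> s k" "v \<preceq> s l"
    using s u v by (auto simp: seq_class_in_cylinder_iff)
  then have "u \<preceq> s (max k l)" "v \<preceq> s (max k l)"
    using traces.divides_trans[OF _ trace_seqs_mono[OF s(1)]] u(1) v(1)
    by (meson max.cobounded1 max.cobounded2)+
  moreover have "\<xi> \<in> \<up> (s (max k l))"
    using s trace_seqs_carrier[OF s(1)] \<open>\<xi> \<in> boundary \<Sigma> I\<close>
    by (auto simp: seq_class_in_cylinder_iff)
  ultimately show "\<exists>x\<in>multiples u \<inter> multiples v. \<xi> \<in> \<up> x"
    using trace_seqs_carrier[OF s(1)]
    by (intro bexI[of _ "s (max k l)"]) (simp_all add: multiples_def)
qed

lemma boundary_eq_Union_cylinder_letters: "boundary \<Sigma> I = (\<Union>a\<in>\<Sigma>. \<up> (T [a]))"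
proof (intro equalityI subsetI)
  fix \<xi> assume \<xi>: "\<xi> \<in> boundary \<Sigma> I"
  then obtain s where s: "s \<in> trace_seqs \<Sigma> I" "\<xi> = seq_class s" by (rule boundaryE)
  obtain k where "0 < trace_length (s k)"
    using \<xi> s seq_class_in_boundary_iff by metis
  then have "s k \<noteq> \<epsilon>" using trace_length_trace_of[of "[]"] by (auto simp: empty_trace_eq)
  then obtain a where "a \<in> \<Sigma>" "T [a] \<preceq> s k"
    using first_letters_eq_empty_iff trace_seqs_carrier[OF s(1)] by (auto simp: first_letters_def)
  then show "\<xi> \<in> (\<Union>a\<in>\<Sigma>. \<up> (T [a]))" using \<xi> s by (auto simp: seq_class_in_cylinder_iff)
qed (use cylinder_subset_boundary in blast)

lemma sets_boundary_space:
  "sets (boundary_space \<Sigma> I) = sigma_sets (boundary \<Sigma> I) (\<up> ` carrier M)"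
  using cylinder_subset_boundary
  by (simp add: boundary_space_def sets_measure_of image_subset_iff)

section \<open>Bernoulli measures induce Moebius valuations\<close>

lemma divisor_letter_in_first_letters:
  assumes "u \<in> carrier M" "x \<in> carrier M" "u \<preceq> x" "a \<in> first_letters x" "a \<in> letters u"
  shows "a \<in> first_letters u"
proof -
  have "a \<in> \<Sigma>" "T [a] \<preceq> x" using assms(4) by (simp_all add: first_letters_def)
  then have "T [a] \<preceq> u"
    using divides_iff_letter_count_le[of "T [a]" u x] assms by (simp add: letters_def Suc_le_eq)
  then show ?thesis using \<open>a \<in> \<Sigma>\<close> by (simp add: first_letters_def)
qed

lemma first_letters_mult_dependent_letter:
  assumes u: "u \<in> carrier M" and bc: "(b, c) \<in> D" "b \<in> letters u" "c \<notin> letters u"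
  shows "first_letters (u \<odot> T [c]) = first_letters u"
proof -
  have c: "c \<in> \<Sigma>" and "(b, c) \<notin> I" using bc(1) by (auto simp: D_def)
  have u_uc: "u \<preceq> u \<odot> T [c]" using c by (simp add: traces.divides_mult)
  show ?thesis
  proof (intro equalityI subsetI)
    fix a assume a: "a \<in> first_letters (u \<odot> T [c])"
    have "a \<in> letters u"
    proof (rule ccontr)
      assume "a \<notin> letters u"
      then have "a = c" using a first_letters_subset_letters[of "u \<odot> T [c]"] u c by auto
      then have "letters u \<subseteq> {b. (b, c) \<in> I}"
        using mult_letter_divides(2)[OF u _ c u_uc] a bc(3) u c by (simp add: first_letters_def)
      then show False using bc(2) \<open>(b, c) \<notin> I\<close> by blast
    qed
    then show "a \<in> first_letters u" using divisor_letter_in_first_letters[OF u _ u_uc a] u c by simp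
  next
    fix a assume "a \<in> first_letters u"
    then show "a \<in> first_letters (u \<odot> T [c])"
      using traces.divides_trans[OF _ u_uc] by (simp add: first_letters_def)
  qed
qed

lemma full_trace_with_first_letters_exists:
  assumes irr: "irreducible_trace_monoid \<Sigma> I" and d: "clique_set d" "d \<noteq> {}"
  obtains u where "u \<in> carrier M" "first_letters u = d" "letters u = \<Sigma>"
proof -
  let ?Q = "\<lambda>u. u \<in> carrier M \<and> first_letters u = d"
  have "?Q (clique_trace d)" using d(1) by (simp add: first_letters_clique_trace)
  moreover have "\<forall>u. ?Q u \<longrightarrow> card (letters u) < Suc (card \<Sigma>)"
    using finite_letters letters_subset by (auto simp: less_Suc_eq_le intro!: card_mono)
  ultimately obtain u where u: "u \<in> carrier M" "first_letters u = d"
    and max: "\<forall>v. ?Q v \<longrightarrow> card (letters v) \<le> card (letters u)"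
    using ex_has_greatest_nat[of ?Q _ "\<lambda>u. card (letters u)"] by metis
  have "D `` letters u \<subseteq> letters u"
  proof (rule ccontr)
    assume "\<not> D `` letters u \<subseteq> letters u"
    then obtain b c where bc: "(b, c) \<in> D" "b \<in> letters u" "c \<notin> letters u" by blast
    then have c: "c \<in> \<Sigma>" using dep_letters by blast
    then have "card (letters (u \<odot> T [c])) \<le> card (letters u)"
      using max[rule_format, of "u \<odot> T [c]"] u first_letters_mult_dependent_letter[OF u(1) bc]
      by simp
    moreover have "finite (letters u)"
      using letters_subset[OF u(1)] finite_letters by (rule finite_subset)
    ultimately show False using u(1) c bc(3) by simp
  qed
  then have "D\<^sup>* `` letters u = letters u" by (rule Image_closed_trancl)
  moreover obtain a where "a \<in> letters u" "a \<in> \<Sigma>"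
    using d u first_letters_subset_letters letters_subset by blast
  moreover have "\<Sigma> \<subseteq> D\<^sup>* `` {a}"
    using irr \<open>a \<in> \<Sigma>\<close> by (auto simp: irreducible_trace_monoid_def D_def)
  ultimately have "letters u = \<Sigma>" using letters_subset[OF u(1)] by blast
  with u show thesis by (rule that)
qed

text \<open>The difference consists of the infinite traces whose first clique is \<open>d\<close>.\<close>

lemma cylinder_subset_first_clique:
  assumes irr: "irreducible_trace_monoid \<Sigma> I" and d: "clique_set d" "d \<noteq> {}"
  obtains u where "u \<in> carrier M"
    "\<up> u \<subseteq> \<up> (clique_trace d) - (\<Union>a\<in>commuting_letters d. \<up> (clique_trace d \<odot> T [a]))"
proof -
  obtain u where u: "u \<in> carrier M" "first_letters u = d" "letters u = \<Sigma>"
    using full_trace_with_first_letters_exists[OF assms] .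
  have "clique_trace d \<preceq> u" using u d(1) by (simp add: clique_trace_divides_iff)
  then have "\<up> u \<subseteq> \<up> (clique_trace d)" using cylinder_mono u(1) d(1) by simp
  moreover have "\<up> u \<inter> \<up> (clique_trace d \<odot> T [a]) = {}" if a: "a \<in> commuting_letters d" for a
  proof (rule ccontr)
    have "a \<in> \<Sigma>" "a \<notin> d" using a indep_neq by (auto simp: commuting_letters_def)
    then have clq: "clique_set (d \<union> {a})"
      using a d(1) by (subst clique_set_Un_iff) (auto simp: clique_set_def)
    have da: "clique_trace d \<odot> T [a] = clique_trace (d \<union> {a})"
      using clique_trace_Un[OF clq] \<open>a \<in> \<Sigma>\<close> \<open>a \<notin> d\<close> by (simp add: clique_trace_singleton)
    assume "\<up> u \<inter> \<up> (clique_trace d \<odot> T [a]) \<noteq> {}"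
    then obtain x where x: "x \<in> carrier M" "u \<preceq> x" "clique_trace (d \<union> {a}) \<preceq> x"
      using divisor_events_common_multiple[OF divisor_events_cylinder u(1)] clq
      by (metis da disjoint_iff clique_trace_carrier)
    then have "a \<in> first_letters x" using clq by (simp add: clique_trace_divides_iff)
    then have "a \<in> first_letters u"
      using divisor_letter_in_first_letters u(1,3) x \<open>a \<in> \<Sigma>\<close> by blast
    then show False using u(2) \<open>a \<notin> d\<close> by simp
  qed
  ultimately show thesis using that u(1) by blast
qed

lemma bernoulli_moebius_valuation:
  assumes irr: "irreducible_trace_monoid \<Sigma> I" and P: "bernoulli_measure \<Sigma> I P"
  shows "moebius_valuation \<Sigma> I (\<lambda>u. measure P (\<up> u))"
proof -
  let ?f = "\<lambda>u. measure P (\<up> u)"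
  have f: "valuation \<Sigma> I ?f" using P by (simp add: bernoulli_measure_def valuation_def)
  interpret prob_space P using P by (simp add: bernoulli_measure_def)
  have cylinder_sets: "\<up> u \<in> sets P" if "u \<in> carrier M" for u
    using P that by (simp add: bernoulli_measure_def sets_boundary_space)
  have measure_Diff: "measure P (\<up> v - (\<Union>a\<in>N. \<up> (v \<odot> T [a]))) = ?f v * clique_poly ?f N"
    if "v \<in> carrier M" "N \<subseteq> \<Sigma>" for v N
    using that cylinder_sets f finite_measure_axioms
    by (intro measure_divisor_events_Diff divisor_events_cylinder) simp_all
  have "moebius_transform \<Sigma> I ?f \<epsilon> = measure P (\<up> \<epsilon> - (\<Union>a\<in>\<Sigma>. \<up> (\<epsilon> \<odot> T [a])))"
    using measure_Diff[of \<epsilon> \<Sigma>] moebius_transform_one[OF f] valuation_one[OF f] by simp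
  also have "\<up> \<epsilon> - (\<Union>a\<in>\<Sigma>. \<up> (\<epsilon> \<odot> T [a])) = {}"
    by (simp add: cylinder_one boundary_eq_Union_cylinder_letters)
  finally have "moebius_transform \<Sigma> I ?f \<epsilon> = 0" by simp
  moreover have "moebius_transform \<Sigma> I ?f c > 0" if c: "c \<in> trace_cliques \<Sigma> I - {\<epsilon>}" for c
  proof -
    obtain d where d: "clique_set d" "c = clique_trace d" "d \<noteq> {}"
      using c clique_trace_empty unfolding trace_cliques_eq by blast
    let ?A = "\<up> c - (\<Union>a\<in>commuting_letters d. \<up> (c \<odot> T [a]))"
    obtain u where u: "u \<in> carrier M" "\<up> u \<subseteq> ?A"
      using cylinder_subset_first_clique[OF irr d(1,3)] d(2) by metis
    have commuting: "commuting_letters d \<subseteq> \<Sigma>" by (auto simp: commuting_letters_def)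
    then have "finite (commuting_letters d)" using finite_letters finite_subset by blast
    then have "?A \<in> sets P"
      using commuting d by (intro sets.Diff sets.finite_UN cylinder_sets) auto
    have "0 < measure P (\<up> u)" using P u(1) by (simp add: bernoulli_measure_def)
    also have "\<dots> \<le> measure P ?A" using u(2) \<open>?A \<in> sets P\<close> by (rule finite_measure_mono)
    also have "\<dots> = moebius_transform \<Sigma> I ?f c"
      using measure_Diff[OF _ commuting] moebius_transform_eq_clique_poly[OF f d(1)] d by simp
    finally show ?thesis .
  qed
  ultimately show ?thesis using f by (simp add: moebius_valuation_def)
qed

section \<open>Uniqueness of the Bernoulli measure\<close>

lemma bernoulli_measure_eqI:
  assumes P: "bernoulli_measure \<Sigma> I P" and Q: "bernoulli_measure \<Sigma> I Q"
    and eq: "\<And>u. u \<in> carrier M \<Longrightarrow> measure P (\<up> u) = measure Q (\<up> u)"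
  shows "P = Q"
proof -
  interpret P: prob_space P using P by (simp add: bernoulli_measure_def)
  interpret Q: prob_space Q using Q by (simp add: bernoulli_measure_def)
  let ?G = "insert {} (\<up> ` carrier M)"
  have "sigma_sets (boundary \<Sigma> I) ?G = sigma_sets (boundary \<Sigma> I) (\<up> ` carrier M)"
    by (rule sigma_sets_eqI) (auto intro: sigma_sets.Empty sigma_sets.Basic)
  then have sets: "sets P = sigma_sets (boundary \<Sigma> I) ?G" "sets Q = sigma_sets (boundary \<Sigma> I) ?G"
    using P Q by (simp_all add: bernoulli_measure_def sets_boundary_space)
  show ?thesis
  proof (rule measure_eqI_generator_eq[where E = ?G and \<Omega> = "boundary \<Sigma> I"
        and A = "\<lambda>_. boundary \<Sigma> I"])
    show "Int_stable ?G"
    proof (rule Int_stableI)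
      fix A B assume "A \<in> ?G" "B \<in> ?G"
      then show "A \<inter> B \<in> ?G"
        using divisor_events_Int[OF divisor_events_cylinder, simplified]
        by (elim insertE imageE) simp_all
    qed
    show "?G \<subseteq> Pow (boundary \<Sigma> I)" using cylinder_subset_boundary by blast
    show "emeasure P X = emeasure Q X" if "X \<in> ?G" for X
      using that eq by (auto simp: P.emeasure_eq_measure Q.emeasure_eq_measure)
    show "range (\<lambda>_::nat. boundary \<Sigma> I) \<subseteq> ?G" using cylinder_one traces.one_closed by blast
  qed (use sets in simp_all)
qed

end

section \<open>Inverse limits of discrete distributions\<close>

locale pmf_inverse_sequence =
  fixes Q :: "nat \<Rightarrow> 'b pmf" and step :: "nat \<Rightarrow> 'b \<Rightarrow> 'b"
  assumes map_pmf_step: "map_pmf (step n) (Q (Suc n)) = Q n"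
begin

text \<open>Unspecified if \<open>x\<close> is not in the support of \<open>Q n\<close>.\<close>

definition fibre_pmf :: "nat \<Rightarrow> 'b \<Rightarrow> 'b pmf" where
  "fibre_pmf n x = cond_pmf (Q (Suc n)) {y. step n y = x}"

lemma set_pmf_eq_image: "set_pmf (Q n) = step n ` set_pmf (Q (Suc n))"
  by (simp flip: map_pmf_step[of n])

lemma set_fibre_pmf:
  "x \<in> set_pmf (Q n) \<Longrightarrow> set_pmf (fibre_pmf n x) = set_pmf (Q (Suc n)) \<inter> {y. step n y = x}"
  unfolding fibre_pmf_def by (rule set_cond_pmf) (auto simp: set_pmf_eq_image[of n])

lemma bind_fibre_pmf: "bind_pmf (Q n) (fibre_pmf n) = Q (Suc n)"
  unfolding fibre_pmf_def
proof (rule bind_cond_pmf_cancel)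
  show "measure (Q (Suc n)) {y. step n y = x} = measure (Q n) {x. step n y = x}"
    if "step n y = x" for x y
    using that by (simp add: vimage_def eq_commute flip: map_pmf_step[of n])
qed (auto simp: set_pmf_eq_image[of n])

primrec transition_pmf :: "nat \<Rightarrow> (nat \<Rightarrow> 'b) \<Rightarrow> 'b pmf" where
  "transition_pmf 0 s = Q 0"
| "transition_pmf (Suc n) s = fibre_pmf n (s n)"

abbreviation seq_space :: "nat set \<Rightarrow> (nat \<Rightarrow> 'b) measure" where
  "seq_space J \<equiv> PiM J (\<lambda>_. count_space UNIV)"

lemma measurable_coordinate [measurable]:
  "n \<in> J \<Longrightarrow> (\<lambda>s. s n) \<in> measurable (seq_space J) (count_space UNIV)"
  by (rule measurable_component_singleton)

sublocale Ionescu_Tulcea "\<lambda>n s. measure_pmf (transition_pmf n s)" "\<lambda>_. count_space UNIV"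
proof
  show "(\<lambda>s. measure_pmf (transition_pmf n s)) \<in>
      measurable (seq_space {0..<n}) (subprob_algebra (count_space UNIV))" for n
  proof (cases n)
    case (Suc k)
    have "(\<lambda>s. s k) \<in> measurable (seq_space {0..<n}) (count_space UNIV)"
      using Suc by (intro measurable_coordinate) simp
    then have "(\<lambda>s. measure_pmf (fibre_pmf k (s k))) \<in>
        measurable (seq_space {0..<n}) (subprob_algebra (count_space UNIV))"
      by (rule measurable_compose) (simp add: measure_pmf_in_subprob_algebra)
    then show ?thesis by (simp add: Suc)
  qed (simp add: measure_pmf_in_subprob_algebra)
qed

abbreviation prefix_law :: "nat \<Rightarrow> (nat \<Rightarrow> 'b) measure" where
  "prefix_law n \<equiv> C 0 n (\<lambda>_. undefined)"

lemma prefix_law_Suc: "prefix_law (Suc n) = prefix_law n \<bind> eP n"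
  by simp

declare C.simps(2) [simp del]

lemma sets_prefix_law [measurable_cong]: "sets (prefix_law n) = sets (seq_space {0..<n})"
  using sets_C[of "\<lambda>_. undefined" 0 n] by (simp add: space_PiM)

lemma measurable_coordinate_prefix_law:
  "i < n \<Longrightarrow> (\<lambda>s. s i) \<in> measurable (prefix_law n) (count_space UNIV)"
  by (simp add: measurable_cong_sets[OF sets_prefix_law HOL.refl] measurable_coordinate)

lemma prob_space_prefix_law: "prob_space (prefix_law n)"
  by (rule prob_space_C) (simp add: space_PiM)

lemma measurable_eP_prefix_law:
  "eP n \<in> measurable (prefix_law n) (subprob_algebra (seq_space {0..<Suc n}))"
  using measurable_eP[of n] by (simp cong: measurable_cong_sets add: sets_prefix_law)

lemma fun_upd_seq_space:
  "s \<in> space (seq_space {0..<n}) \<Longrightarrow> s(n := x) \<in> space (seq_space {0..<Suc n})"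
  by (auto simp: space_PiM PiE_iff extensional_def)

lemma distr_eP_last:
  assumes "s \<in> space (seq_space {0..<n})"
  shows "distr (eP n s) (count_space UNIV) (\<lambda>s. s n) = measure_pmf (transition_pmf n s)"
proof -
  have "distr (eP n s) (count_space UNIV) (\<lambda>s. s n) =
      distr (measure_pmf (transition_pmf n s)) (count_space UNIV) ((\<lambda>s. s n) \<circ> fun_upd s n)"
    unfolding eP_def using assms
    by (intro distr_distr measurable_coordinate) (simp_all add: fun_upd_seq_space)
  also have "\<dots> =
      distr (measure_pmf (transition_pmf n s)) (measure_pmf (transition_pmf n s)) (\<lambda>x. x)"
    by (rule distr_cong) simp_all
  finally show ?thesis by (simp add: distr_id)
qed

lemma distr_prefix_law_last:
  "distr (prefix_law (Suc n)) (count_space UNIV) (\<lambda>s. s n) = measure_pmf (Q n)"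
proof (induction n)
  case 0
  show ?case
    using distr_eP_last[of "\<lambda>_. undefined" 0] measurable_eP[of 0]
    by (simp add: prefix_law_Suc space_PiM bind_return)
next
  case (Suc n)
  have nonempty: "space (prefix_law (Suc n)) \<noteq> {}"
    using prob_space.not_empty[OF prob_space_prefix_law] .
  have "distr (prefix_law (Suc (Suc n))) (count_space UNIV) (\<lambda>s. s (Suc n)) =
      prefix_law (Suc n) \<bind> (\<lambda>s. distr (eP (Suc n) s) (count_space UNIV) (\<lambda>s. s (Suc n)))"
    unfolding prefix_law_Suc[of "Suc n"]
    by (rule distr_bind[OF measurable_eP_prefix_law nonempty measurable_coordinate]) simp
  also have "\<dots> = prefix_law (Suc n) \<bind> (\<lambda>s. measure_pmf (fibre_pmf n (s n)))"
    by (intro bind_cong) (simp_all add: distr_eP_last sets_eq_imp_space_eq[OF sets_prefix_law])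
  also have "\<dots> = distr (prefix_law (Suc n)) (count_space UNIV) (\<lambda>s. s n) \<bind>
      (\<lambda>x. measure_pmf (fibre_pmf n x))"
    using nonempty measurable_coordinate_prefix_law[of n "Suc n"]
    by (intro bind_distr[where K = "count_space UNIV", symmetric])
      (simp_all add: measure_pmf_in_subprob_algebra)
  also have "\<dots> = measure_pmf (Q (Suc n))"
    by (simp add: Suc bind_fibre_pmf flip: measure_pmf_bind)
  finally show ?case .
qed

lemma distr_lim_prefix: "distr PF.lim (seq_space {0..<n}) (\<lambda>s. restrict s {0..<n}) = prefix_law n"
proof -
  have "up_to {0..<n} = n" using up_to[of "{0..<n}"] by (intro antisym) (auto simp: up_to_iff)
  then have "distr PF.lim (seq_space {0..<n}) (\<lambda>s. restrict s {0..<n}) =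
      distr (prefix_law n) (seq_space {0..<n}) (\<lambda>s. restrict s {0..<n})"
    by (simp add: distr_lim CI_def)
  also have "\<dots> = distr (prefix_law n) (prefix_law n) (\<lambda>s. s)"
    by (rule distr_cong)
      (auto simp: sets_prefix_law sets_eq_imp_space_eq[OF sets_prefix_law] space_PiM)
  finally show ?thesis by (simp add: distr_id)
qed

lemma measurable_restrict_lim [measurable]:
  "(\<lambda>s. restrict s J) \<in> measurable PF.lim (seq_space J)"
  using measurable_restrict_subset[of J UNIV] by (simp cong: measurable_cong_sets)

lemma measurable_coordinate_lim: "(\<lambda>s. s n) \<in> measurable PF.lim (count_space UNIV)"
  using measurable_coordinate[of n UNIV] measurable_cong_sets[OF PF.sets_lim HOL.refl] by blast

lemma distr_lim_coordinate: "distr PF.lim (count_space UNIV) (\<lambda>s. s n) = measure_pmf (Q n)"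
proof -
  have "distr PF.lim (count_space UNIV) (\<lambda>s. s n) =
      distr (distr PF.lim (seq_space {0..<Suc n}) (\<lambda>s. restrict s {0..<Suc n}))
        (count_space UNIV) (\<lambda>s. s n)"
    by (subst distr_distr) (auto simp: comp_def)
  then show ?thesis by (simp only: distr_lim_prefix distr_prefix_law_last)
qed

definition coherent_at :: "nat \<Rightarrow> (nat \<Rightarrow> 'b) \<Rightarrow> bool" where
  "coherent_at n s \<longleftrightarrow> s n \<in> set_pmf (Q n) \<and> step n (s (Suc n)) = s n"

text \<open>Equality of two coordinates need not be measurable, but the support of \<open>Q n\<close> is countable.\<close>

lemma pred_coherent_at:
  assumes "n \<in> J" "Suc n \<in> J"
  shows "Measurable.pred (seq_space J) (coherent_at n)"
proof -
  have "{s \<in> space (seq_space J). \<exists>x\<in>set_pmf (Q n). s n = x \<and> step n (s (Suc n)) = x}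
      \<in> sets (seq_space J)"
  proof (rule sets.sets_Collect_countable_Ex'[OF _ countable_set_pmf])
    fix x
    have "Measurable.pred (seq_space J) (\<lambda>s. s n = x)"
      "Measurable.pred (seq_space J) (\<lambda>s. step n (s (Suc n)) = x)"
      using assms by (auto intro: measurable_compose[OF measurable_coordinate])
    then have "Measurable.pred (seq_space J) (\<lambda>s. s n = x \<and> step n (s (Suc n)) = x)"
      by (rule pred_intros_logic)
    then show "{s \<in> space (seq_space J). s n = x \<and> step n (s (Suc n)) = x} \<in> sets (seq_space J)"
      by (simp add: pred_def)
  qed
  then show ?thesis by (simp add: pred_def coherent_at_def conj_commute)
qed

lemma AE_prefix_law_coherent_at: "AE s in prefix_law (Suc (Suc n)). coherent_at n s"
proof -
  have "AE x in distr (prefix_law (Suc n)) (count_space UNIV) (\<lambda>s. s n). x \<in> set_pmf (Q n)"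
    unfolding distr_prefix_law_last by (rule AE_measure_pmf)
  then have "AE s in prefix_law (Suc n). s n \<in> set_pmf (Q n)"
    by (rule AE_distrD[OF measurable_coordinate_prefix_law[OF lessI]])
  moreover have "AE s' in eP (Suc n) s. coherent_at n s'"
    if s: "s \<in> space (prefix_law (Suc n))" "s n \<in> set_pmf (Q n)" for s
  proof -
    have "AE y in measure_pmf (transition_pmf (Suc n) s). coherent_at n (s(Suc n := y))"
      using s(2) by (intro AE_pmfI) (simp add: set_fibre_pmf coherent_at_def)
    then show ?thesis
      unfolding eP_def using s(1) pred_coherent_at[of n "{0..<Suc (Suc n)}"]
      by (subst AE_distr_iff)
        (simp_all add: fun_upd_seq_space pred_def sets_eq_imp_space_eq[OF sets_prefix_law])
  qed
  ultimately have "AE s in prefix_law (Suc n). AE s' in eP (Suc n) s. coherent_at n s'"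
    by (auto intro: AE_mp)
  then show ?thesis
    unfolding prefix_law_Suc[of "Suc n"]
    by (subst AE_bind[OF measurable_eP_prefix_law pred_coherent_at]) simp_all
qed

definition coherent_seqs :: "(nat \<Rightarrow> 'b) set" where
  "coherent_seqs = {s. \<forall>n. coherent_at n s}"

lemma coherent_seqs_sets: "coherent_seqs \<in> sets PF.lim"
proof -
  have "Measurable.pred (seq_space UNIV) (\<lambda>s. \<forall>n. coherent_at n s)"
    by (intro pred_intros_countable pred_coherent_at) simp_all
  then show ?thesis by (simp add: pred_def space_PiM coherent_seqs_def)
qed

lemma AE_lim_coherent_seqs: "AE s in PF.lim. s \<in> coherent_seqs"
proof -
  have "AE s in PF.lim. coherent_at n s" for n
  proof -
    have "AE s in PF.lim. coherent_at n (restrict s {0..<Suc (Suc n)})"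
      using AE_prefix_law_coherent_at[of n] unfolding distr_lim_prefix[symmetric]
      by (rule AE_distrD[OF measurable_restrict_lim])
    then show ?thesis by (simp add: coherent_at_def)
  qed
  then show ?thesis by (simp add: coherent_seqs_def AE_all_countable)
qed

definition inverse_limit :: "(nat \<Rightarrow> 'b) measure" where
  "inverse_limit = restrict_space PF.lim coherent_seqs"

lemma space_inverse_limit: "space inverse_limit = coherent_seqs"
  by (simp add: inverse_limit_def space_restrict_space space_PiM)

lemma measurable_coordinate_inverse_limit:
  "(\<lambda>s. s n) \<in> measurable inverse_limit (count_space UNIV)"
  unfolding inverse_limit_def using measurable_coordinate_lim by (rule measurable_restrict_space1)

lemma distr_inverse_limit: "distr inverse_limit (count_space UNIV) (\<lambda>s. s n) = measure_pmf (Q n)"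
proof (rule measure_eqI)
  fix A :: "'b set"
  have A: "(\<lambda>s. s n) -` A \<in> sets PF.lim"
    using measurable_sets[OF measurable_coordinate_lim[of n], of A] by (simp add: space_PiM)
  have "emeasure (distr inverse_limit (count_space UNIV) (\<lambda>s. s n)) A =
      emeasure PF.lim ((\<lambda>s. s n) -` A \<inter> coherent_seqs)"
    using coherent_seqs_sets
    by (simp add: emeasure_distr measurable_coordinate_inverse_limit space_inverse_limit)
      (simp add: inverse_limit_def emeasure_restrict_space space_PiM)
  also have "\<dots> = emeasure PF.lim ((\<lambda>s. s n) -` A)"
    using A coherent_seqs_sets AE_lim_coherent_seqs by (intro emeasure_eq_AE) auto
  also have "\<dots> = emeasure (distr PF.lim (count_space UNIV) (\<lambda>s. s n)) A"
    by (simp add: emeasure_distr measurable_coordinate_lim space_PiM)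
  finally show "emeasure (distr inverse_limit (count_space UNIV) (\<lambda>s. s n)) A = emeasure (Q n) A"
    by (simp add: distr_lim_coordinate)
qed simp

lemma prob_space_inverse_limit: "prob_space inverse_limit"
proof (rule prob_space_distrD)
  show "prob_space (distr inverse_limit (count_space UNIV) (\<lambda>s. s 0))"
    by (simp add: distr_inverse_limit prob_space_measure_pmf)
qed (rule measurable_coordinate_inverse_limit)

end

context independence_pair
begin

section \<open>Moebius valuations induce Bernoulli measures\<close>

definition trunc_pmf :: "('a list set \<Rightarrow> real) \<Rightarrow> ('a \<Rightarrow> nat) \<Rightarrow> 'a list set pmf" where
  "trunc_pmf f K = embed_pmf (\<lambda>u. if u \<in> bounded_traces K then trunc_weight f K u else 0)"

lemma pmf_trunc_pmf:
  assumes f: "moebius_valuation \<Sigma> I f"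
  shows "pmf (trunc_pmf f K) u = (if u \<in> bounded_traces K then trunc_weight f K u else 0)"
  unfolding trunc_pmf_def
proof (rule pmf_embed_pmf)
  let ?B = "bounded_traces K" and ?w = "\<lambda>u. if u \<in> bounded_traces K then trunc_weight f K u else 0"
  have v: "valuation \<Sigma> I f" using f by (rule moebius_valuation_valuation)
  show nonneg: "0 \<le> ?w u" for u
    using valuation_pos[OF v] clique_poly_nonneg[OF f]
    by (simp add: trunc_weight_def bounded_traces_carrier less_imp_le)
  have "(\<integral>\<^sup>+u. ennreal (?w u) \<partial>count_space UNIV) = (\<Sum>u\<in>?B. ennreal (?w u))"
    by (rule nn_integral_count_space') (simp_all add: finite_bounded_traces)
  also have "\<dots> = ennreal (\<Sum>u\<in>?B. ?w u)" using nonneg by (rule sum_ennreal)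
  also have "(\<Sum>u\<in>?B. ?w u) = 1" by (simp add: sum_trunc_weight[OF v])
  finally show "(\<integral>\<^sup>+u. ennreal (?w u) \<partial>count_space UNIV) = 1" by simp
qed

lemma set_trunc_pmf_subset:
  assumes "moebius_valuation \<Sigma> I f"
  shows "set_pmf (trunc_pmf f K) \<subseteq> bounded_traces K"
  by (auto simp: set_pmf_eq pmf_trunc_pmf[OF assms])

text \<open>A trace with no letter count at its bound has weight \<open>f(u) m(\<Sigma>) = f(u) h(\<epsilon>) = 0\<close>.\<close>

lemma set_trunc_pmf_letter_count_eq:
  assumes f: "moebius_valuation \<Sigma> I f" and u: "u \<in> set_pmf (trunc_pmf f K)"
  obtains a where "a \<in> \<Sigma>" "letter_count u a = K a"
proof -
  have uB: "u \<in> bounded_traces K" using set_trunc_pmf_subset[OF f] u by blast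
  have "clique_poly f \<Sigma> = 0"
    using f moebius_transform_one[OF moebius_valuation_valuation[OF f]]
    by (simp add: moebius_valuation_def)
  moreover have "trunc_weight f K u \<noteq> 0" using u uB by (simp add: set_pmf_iff pmf_trunc_pmf[OF f])
  ultimately have "free_letters K u \<noteq> \<Sigma>" by (auto simp: trunc_weight_def)
  then obtain a where "a \<in> \<Sigma>" "\<not> letter_count u a < K a" by (auto simp: free_letters_def)
  then show thesis using that[of a] uB by (simp add: bounded_traces_def not_less antisym)
qed

lemma measure_trunc_pmf_multiples:
  assumes f: "moebius_valuation \<Sigma> I f" and u: "u \<in> bounded_traces K"
  shows "measure (trunc_pmf f K) (multiples u) = f u"
proof -
  have "measure (trunc_pmf f K) (multiples u) =
      measure (trunc_pmf f K) {x. x \<in> bounded_traces K \<and> u \<preceq> x}"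
    using set_trunc_pmf_subset[OF f, of K] bounded_traces_carrier
    by (intro measure_pmf.finite_measure_eq_AE AE_pmfI) (auto simp: multiples_def)
  also have "\<dots> = (\<Sum>x | x \<in> bounded_traces K \<and> u \<preceq> x. pmf (trunc_pmf f K) x)"
    using finite_bounded_traces by (intro measure_measure_pmf_finite) simp
  also have "\<dots> = (\<Sum>x | x \<in> bounded_traces K \<and> u \<preceq> x. trunc_weight f K x)"
    by (intro sum.cong) (simp_all add: pmf_trunc_pmf[OF f])
  also have "\<dots> = f u" using moebius_valuation_valuation[OF f] u by (rule sum_trunc_weight_multiples)
  finally show ?thesis .
qed

lemma map_trunc_trunc_pmf:
  assumes f: "moebius_valuation \<Sigma> I f" and le: "\<And>a. K a \<le> K' a"
  shows "map_pmf (trunc K) (trunc_pmf f K') = trunc_pmf f K"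
proof (rule pmf_eqI)
  fix y
  have carrier: "x \<in> carrier M" if "x \<in> set_pmf (trunc_pmf f K')" for x
    using set_trunc_pmf_subset[OF f] bounded_traces_carrier that by blast
  show "pmf (map_pmf (trunc K) (trunc_pmf f K')) y = pmf (trunc_pmf f K) y"
  proof (cases "y \<in> bounded_traces K")
    case False
    then have "y \<notin> trunc K ` set_pmf (trunc_pmf f K')" using carrier trunc_bounded_traces by blast
    then show ?thesis using False by (simp add: pmf_trunc_pmf[OF f] pmf_eq_0_set_pmf)
  next
    case True
    then have y: "y \<in> carrier M" by (rule bounded_traces_carrier)
    have "pmf (map_pmf (trunc K) (trunc_pmf f K')) y = measure (trunc_pmf f K') (trunc K -` {y})"
      by (rule pmf_map)
    also have "\<dots> = measure (trunc_pmf f K')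
        (multiples y - (\<Union>a\<in>free_letters K y. multiples (y \<odot> T [a])))"
      using carrier trunc_eq_iff[OF _ True]
      by (intro measure_pmf.finite_measure_eq_AE AE_pmfI) (auto simp: multiples_def)
    also have "\<dots> = trunc_weight f K y"
      unfolding trunc_weight_def
    proof (rule measure_divisor_events_Diff[OF measure_pmf.finite_measure_axioms
          divisor_events_multiples])
      fix d assume d: "clique_set d" "d \<subseteq> free_letters K y"
      then have "clique_trace d \<odot> y \<in> bounded_traces K"
        using clique_trace_mult_bounded_traces_iff y True by simp
      then have "y \<odot> clique_trace d \<in> bounded_traces K'"
        using y d(1) le by (auto simp: bounded_traces_def add.commute intro: order_trans)
      then show "measure (trunc_pmf f K') (multiples (y \<odot> clique_trace d)) = f (y \<odot> clique_trace d)"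
        by (rule measure_trunc_pmf_multiples[OF f])
    qed (use y moebius_valuation_valuation[OF f] in \<open>simp_all add: free_letters_def\<close>)
    finally show ?thesis using True by (simp add: pmf_trunc_pmf[OF f])
  qed
qed

lemma pmf_inverse_sequence_trunc_pmf:
  "moebius_valuation \<Sigma> I f \<Longrightarrow>
    pmf_inverse_sequence (\<lambda>n. trunc_pmf f (\<lambda>_. n)) (\<lambda>n. trunc (\<lambda>_. n))"
  by unfold_locales (simp add: map_trunc_trunc_pmf)

definition truncation_seq :: "(nat \<Rightarrow> 'a list set) \<Rightarrow> bool" where
  "truncation_seq s \<longleftrightarrow> (\<forall>n. s n \<in> bounded_traces (\<lambda>_. n) \<and> n \<le> trace_length (s n) \<and>
    trunc (\<lambda>_. n) (s (Suc n)) = s n)"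

lemma truncation_seq_carrier: "truncation_seq s \<Longrightarrow> s n \<in> carrier M"
  using bounded_traces_carrier by (auto simp: truncation_seq_def)

lemma truncation_seq_mono:
  assumes s: "truncation_seq s" and "m \<le> n"
  shows "s m \<preceq> s n"
  using \<open>m \<le> n\<close>
proof (induction n rule: dec_induct)
  case base
  show ?case using truncation_seq_carrier[OF s] by simp
next
  case (step n)
  have "s n \<preceq> s (Suc n)"
    using s trunc_divides[OF truncation_seq_carrier[OF s, of "Suc n"], of "\<lambda>_. n"]
    by (simp add: truncation_seq_def)
  with step.IH show ?case using truncation_seq_carrier[OF s] by (rule traces.divides_trans)
qed

lemma truncation_seq_divides:
  assumes s: "truncation_seq s" and u: "u \<in> bounded_traces (\<lambda>_. n)" "u \<preceq> s k"
  shows "u \<preceq> s n"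
proof (cases "k \<le> n")
  case True
  show ?thesis
    using u(2) truncation_seq_mono[OF s True] bounded_traces_carrier[OF u(1)]
    by (rule traces.divides_trans)
next
  case False
  then have "n \<le> k" by simp
  then show ?thesis using u(2)
  proof (induction k rule: dec_induct)
    case (step k)
    have "u \<in> bounded_traces (\<lambda>_. k)"
      using u(1) step.hyps by (auto simp: bounded_traces_def intro: order_trans)
    then have "u \<preceq> trunc (\<lambda>_. k) (s (Suc k))"
      using divides_trunc truncation_seq_carrier[OF s] step.prems by blast
    then show ?case using step.IH s by (simp add: truncation_seq_def)
  qed
qed

lemma truncation_seq_trace_seqs: "truncation_seq s \<Longrightarrow> s \<in> trace_seqs \<Sigma> I"
  using truncation_seq_carrier truncation_seq_mono by (auto simp: trace_seqs_def monotone_def)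

lemma truncation_seq_boundary:
  assumes "truncation_seq s"
  shows "seq_class s \<in> boundary \<Sigma> I"
  using assms less_le_trans[OF lessI]
  unfolding seq_class_in_boundary_iff[OF truncation_seq_trace_seqs[OF assms]] truncation_seq_def
  by blast

lemma truncation_seq_cylinder_iff:
  assumes s: "truncation_seq s" and u: "u \<in> carrier M"
  shows "seq_class s \<in> \<up> u \<longleftrightarrow> u \<preceq> s (trace_length u)"
proof -
  have "u \<in> bounded_traces (\<lambda>_. trace_length u)"
    using u by (simp add: bounded_traces_def letter_count_le_trace_length)
  then have "(\<exists>k. u \<preceq> s k) \<longleftrightarrow> u \<preceq> s (trace_length u)"
    using truncation_seq_divides[OF s] by blast
  then show ?thesis
    using seq_class_in_cylinder_iff[OF truncation_seq_trace_seqs[OF s] u]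
      truncation_seq_boundary[OF s] by simp
qed

lemma truncation_seq_if_in_support:
  assumes f: "moebius_valuation \<Sigma> I f"
    and s: "\<And>n. s n \<in> set_pmf (trunc_pmf f (\<lambda>_. n))" "\<And>n. trunc (\<lambda>_. n) (s (Suc n)) = s n"
  shows "truncation_seq s"
  unfolding truncation_seq_def
proof (intro allI conjI)
  fix n
  show bounded: "s n \<in> bounded_traces (\<lambda>_. n)" using set_trunc_pmf_subset[OF f] s(1) by blast
  obtain a where "letter_count (s n) a = n" using set_trunc_pmf_letter_count_eq[OF f s(1)] .
  then show "n \<le> trace_length (s n)"
    using letter_count_le_trace_length[OF bounded_traces_carrier[OF bounded]] by metis
qed (rule s(2))

context
  fixes L :: "(nat \<Rightarrow> 'a list set) measure"
  assumes truncation_seqs: "\<And>s. s \<in> space L \<Longrightarrow> truncation_seq s"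
    and coordinates: "\<And>n. (\<lambda>s. s n) \<in> measurable L (count_space UNIV)"
begin

lemma vimage_seq_class_cylinder:
  assumes "u \<in> carrier M"
  shows "seq_class -` \<up> u \<inter> space L = (\<lambda>s. s (trace_length u)) -` multiples u \<inter> space L"
  using truncation_seq_cylinder_iff[OF truncation_seqs assms]
    truncation_seq_carrier[OF truncation_seqs]
  by (auto simp: multiples_def)

lemma measurable_seq_class: "seq_class \<in> measurable L (boundary_space \<Sigma> I)"
  unfolding boundary_space_def
proof (rule measurable_measure_of)
  show "\<up> ` carrier M \<subseteq> Pow (boundary \<Sigma> I)" using cylinder_subset_boundary by blast
  show "seq_class \<in> space L \<rightarrow> boundary \<Sigma> I" using truncation_seqs truncation_seq_boundary by blast
  show "seq_class -` A \<inter> space L \<in> sets L" if "A \<in> \<up> ` carrier M" for A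
    using that measurable_sets[OF coordinates] vimage_seq_class_cylinder by auto
qed

lemma measure_distr_seq_class_cylinder:
  assumes u: "u \<in> carrier M"
  shows "measure (distr L (boundary_space \<Sigma> I) seq_class) (\<up> u) =
    measure (distr L (count_space UNIV) (\<lambda>s. s (trace_length u))) (multiples u)"
proof -
  have "\<up> u \<in> sets (boundary_space \<Sigma> I)" using u by (simp add: sets_boundary_space)
  then show ?thesis
    using u by (simp add: measure_distr measurable_seq_class coordinates vimage_seq_class_cylinder)
qed

end

lemma bernoulli_measure_exists:
  assumes f: "moebius_valuation \<Sigma> I f"
  shows "\<exists>P. bernoulli_measure \<Sigma> I P \<and> (\<forall>u\<in>carrier M. measure P (\<up> u) = f u)"
proof -
  interpret trunc: pmf_inverse_sequence "\<lambda>n. trunc_pmf f (\<lambda>_. n)" "\<lambda>n. trunc (\<lambda>_. n)"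
    using f by (rule pmf_inverse_sequence_trunc_pmf)
  let ?L = trunc.inverse_limit
  define P where "P = distr ?L (boundary_space \<Sigma> I) seq_class"
  have truncation_seqs: "truncation_seq s" if "s \<in> space ?L" for s
    using that by (intro truncation_seq_if_in_support[OF f])
      (simp_all add: trunc.space_inverse_limit trunc.coherent_seqs_def trunc.coherent_at_def)
  note coordinates = trunc.measurable_coordinate_inverse_limit
  have "prob_space P"
    unfolding P_def
    using trunc.prob_space_inverse_limit measurable_seq_class[OF truncation_seqs coordinates]
    by (rule prob_space.prob_space_distr)
  moreover have P_cylinder: "measure P (\<up> u) = f u" if u: "u \<in> carrier M" for u
  proof -
    have "measure P (\<up> u) = measure (trunc_pmf f (\<lambda>_. trace_length u)) (multiples u)"
      using measure_distr_seq_class_cylinder[OF truncation_seqs coordinates u]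
      by (simp add: P_def trunc.distr_inverse_limit)
    also have "\<dots> = f u"
      using u by (intro measure_trunc_pmf_multiples[OF f])
        (simp add: bounded_traces_def letter_count_le_trace_length)
    finally show ?thesis .
  qed
  ultimately have "bernoulli_measure \<Sigma> I P"
    using moebius_valuation_valuation[OF f]
    by (simp add: bernoulli_measure_def valuation_def P_def)
  then show ?thesis using P_cylinder by blast
qed

end

theorem theorem2p4:
  fixes \<Sigma> :: "'a set" and I :: "('a \<times> 'a) set"
  assumes "independence_pair \<Sigma> I"
    and "irreducible_trace_monoid \<Sigma> I"
  shows "(\<forall>P. bernoulli_measure \<Sigma> I P \<longrightarrow>
            moebius_valuation \<Sigma> I (\<lambda>u. measure P (cylinder \<Sigma> I u))) \<and>
         (\<forall>f. moebius_valuation \<Sigma> I f \<longrightarrow>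
            (\<exists>!P. bernoulli_measure \<Sigma> I P \<and>
                  (\<forall>u\<in>carrier (trace_monoid \<Sigma> I). measure P (cylinder \<Sigma> I u) = f u)))"
proof (intro conjI allI impI)
  interpret independence_pair \<Sigma> I by fact
  show "moebius_valuation \<Sigma> I (\<lambda>u. measure P (cylinder \<Sigma> I u))" if "bernoulli_measure \<Sigma> I P" for P
    using assms(2) that by (rule bernoulli_moebius_valuation)
  show "\<exists>!P. bernoulli_measure \<Sigma> I P \<and> (\<forall>u\<in>carrier M. measure P (cylinder \<Sigma> I u) = f u)"
    if "moebius_valuation \<Sigma> I f" for f
  proof (rule ex_ex1I)
    show "\<exists>P. bernoulli_measure \<Sigma> I P \<and> (\<forall>u\<in>carrier M. measure P (cylinder \<Sigma> I u) = f u)"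
      using that by (rule bernoulli_measure_exists)
  qed (rule bernoulli_measure_eqI, auto)
qed

end
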